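(* There exists a universal constant $C>0$ such that the following holds. Let $\Omega\subset\mathbb R^2$ be a compact convex set, let $h>0$ be such that $\operatorname{diam}(\Omega)/h\ge2$, and let $U:\Omega\to\mathbb R$ be convex. For $\theta\in\mathbb R$, $\xi\in\mathbb R^2$ let $X_\theta^\xi:=\Omega\cap hR_\theta(\xi+\mathbb Z^2)$ and let $\mathcal V_\theta^\xi$ be the minimal (smallest for inclusion) family of stencils on $X_\theta^\xi$ such that $U_{|X_\theta^\xi}\in\mathrm{Conv}(\mathcal V_\theta^\xi)$. Then $$\int_{[0,1]^2}\int_0^{\pi/2}\#(\mathcal V_\theta^\xi)\,d\theta\,d\xi\le C\,\frac{|\Omega|}{h^2}\,\Big(\ln\frac{\operatorname{diam}(\Omega)}{h}\Big)^2 .$$ (The constant $C$ is independent of $h,\Omega,U$.)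
   Context: $\|\cdot\|$ is the Euclidean norm, $R_\theta$ the rotation of $\mathbb R^2$ by angle $\theta$, $|\Omega|$ the area of $\Omega$, $\operatorname{diam}(\Omega):=\max\{\|y-x\|:x,y\in\Omega\}$. A vector $e=(\alpha,\beta)\in\mathbb Z^2$ is irreducible iff $\gcd(\alpha,\beta)=1$. A basis of $\mathbb Z^2$ is a pair $(f,g)\in(\mathbb Z^2)^2$ with $|\det(f,g)|=1$; direct iff $\det(f,g)=1$, acute iff $\langle f,g\rangle\ge0$. For each irreducible $e$ with $\|e\|>1$ there is a unique direct acute basis $(f,g)$ with $e=f+g$; $f,g$ are called the parents of $e$. Unit vectors have no parents. Fix $X=X_\theta^\xi$. $\mathrm{Conv}(X)$ is the set of restrictions to $X$ of convex functions $\Omega\to\mathbb R$. For $x\in X$ write $x\oplus e:=x+hR_\theta e$. Linear forms: $S_x^e(u):=u(x\oplus e)-2u(x)+u(x\oplus(-e))$ for $e$ irreducible; for $e$ irreducible with $\|e\|>1$, of parents $f,g$, $T_x^e(u):=u(x\oplus e)+u(x\oplus(-f))+u(x\oplus(-g))-3u(x)$ and $P_x^e(u):=u(x\oplus e)-u(x\oplus f)-u(x\oplus g)+u(x)$. The support of a form is the set of points at which $u$ is evaluated. $\mathcal V_{\max}(x):=\{e\in\mathbb Z^2\text{ irreducible}: x\oplus e\in X\}$. $\mathrm{Cone}(A)$ is the convex cone generated by $A$, with $\mathrm{Cone}(\emptyset)=\{0\}$. A family of stencils on $X$ is a collection $\mathcal V=(\mathcal V(x))_{x\in X}$, $\mathcal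 V(x)\subseteq\mathcal V_{\max}(x)$, such that for all $x\in X$: (Stability) any parent $f\in\mathcal V_{\max}(x)$ of any $e\in\mathcal V(x)$ satisfies $f\in\mathcal V(x)$; (Visibility) $\mathrm{Cone}(\mathcal V(x))=\mathrm{Cone}(\mathcal V_{\max}(x))$. The candidates for refinement $\hat{\mathcal V}(x)$ are all $e\in\mathcal V_{\max}(x)\setminus\mathcal V(x)$ having two parents, both in $\mathcal V(x)$. $\mathrm{Conv}(\mathcal V)$ is the set of $u:X\to\mathbb R$ such that for all $x\in X$: $S_x^e(u)\ge0$ for all $e\in\mathcal V(x)$ with $S_x^e$ supported in $X$; $T_x^e(u)\ge0$ for all $e\in\mathcal V(x)$, $\|e\|>1$, with $T_x^e$ supported in $X$; $P_x^e(u)\ge0$ for all $e\in\hat{\mathcal V}(x)$. Families of stencils are ordered by pointwise inclusion; intersections of families of stencils are families of stencils, $\mathrm{Conv}(\mathcal V)\cap\mathrm{Conv}(\mathcal V')=\mathrm{Conv}(\mathcal V\cap\mathcal V')$ and $\mathrm{Conv}(\mathcal V_{\max})=\mathrm{Conv}(X)$, so for $u\in \mathrm{Conv}(X)$ a smallest family $\mathcal V$ with $u\in\mathrm{Conv}(\mathcal V)$ exists. $\#(\mathcal V):=\sum_{x\in X}\#(\mathcal V(x))$. *)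

theory Defs
  imports "HOL-Analysis.Analysis"
begin

text \<open>
  The plane is \<open>real \<times> real\<close>, whose library norm, distance and Lebesgue measure are the
  Euclidean ones; the lattice is \<open>int \<times> int\<close>.
\<close>

definition real_vec :: "int \<times> int \<Rightarrow> real \<times> real" where
  "real_vec e = (of_int (fst e), of_int (snd e))"

definition rot :: "real \<Rightarrow> real \<times> real \<Rightarrow> real \<times> real" where
  "rot \<theta> v = (cos \<theta> * fst v - sin \<theta> * snd v, sin \<theta> * fst v + cos \<theta> * snd v)"

definition grid_points :: "(real \<times> real) set \<Rightarrow> real \<Rightarrow> real \<Rightarrow> real \<times> real \<Rightarrow> (real \<times> real) set" where
  "grid_points \<Omega> h \<theta> \<xi> = \<Omega> \<inter> range (\<lambda>k. h *\<^sub>R rot \<theta> (\<xi> + real_vec k))"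

definition irreducible_vec :: "int \<times> int \<Rightarrow> bool" where
  "irreducible_vec e \<longleftrightarrow> gcd (fst e) (snd e) = 1"

definition det2 :: "int \<times> int \<Rightarrow> int \<times> int \<Rightarrow> int" where
  "det2 f g = fst f * snd g - snd f * fst g"

definition direct_acute_basis :: "int \<times> int \<Rightarrow> int \<times> int \<Rightarrow> bool" where
  "direct_acute_basis f g \<longleftrightarrow> det2 f g = 1 \<and> real_vec f \<bullet> real_vec g \<ge> 0"

text \<open>The parents of \<open>e\<close> are given by a relation rather than by a choice of the (unique) pair.\<close>

definition parents :: "int \<times> int \<Rightarrow> int \<times> int \<Rightarrow> int \<times> int \<Rightarrow> bool" where
  "parents e f g \<longleftrightarrow>
     irreducible_vec e \<and> norm (real_vec e) > 1 \<and> direct_acute_basis f g \<and> e = f + g"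

text \<open>The point \<open>x \<oplus> e\<close>, for the grid scale \<open>h\<close> and the angle \<open>\<theta>\<close>.\<close>

definition shift :: "real \<Rightarrow> real \<Rightarrow> real \<times> real \<Rightarrow> int \<times> int \<Rightarrow> real \<times> real" where
  "shift h \<theta> x e = x + h *\<^sub>R rot \<theta> (real_vec e)"

definition S_form ::
    "real \<Rightarrow> real \<Rightarrow> real \<times> real \<Rightarrow> int \<times> int \<Rightarrow> (real \<times> real \<Rightarrow> real) \<Rightarrow> real" where
  "S_form h \<theta> x e u = u (shift h \<theta> x e) - 2 * u x + u (shift h \<theta> x (- e))"

definition S_support :: "real \<Rightarrow> real \<Rightarrow> real \<times> real \<Rightarrow> int \<times> int \<Rightarrow> (real \<times> real) set" where
  "S_support h \<theta> x e = {shift h \<theta> x e, x, shift h \<theta> x (- e)}"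

text \<open>The forms \<open>T\<close> and \<open>P\<close> of a vector \<open>e\<close> take its parents \<open>f\<close>, \<open>g\<close> as arguments.\<close>

definition T_form ::
    "real \<Rightarrow> real \<Rightarrow> real \<times> real \<Rightarrow> int \<times> int \<Rightarrow> int \<times> int \<Rightarrow> int \<times> int
      \<Rightarrow> (real \<times> real \<Rightarrow> real) \<Rightarrow> real" where
  "T_form h \<theta> x e f g u =
     u (shift h \<theta> x e) + u (shift h \<theta> x (- f)) + u (shift h \<theta> x (- g)) - 3 * u x"

definition T_support ::
    "real \<Rightarrow> real \<Rightarrow> real \<times> real \<Rightarrow> int \<times> int \<Rightarrow> int \<times> int \<Rightarrow> int \<times> int \<Rightarrow> (real \<times> real) set" where
  "T_support h \<theta> x e f g =
     {shift h \<theta> x e, shift h \<theta> x (- f), shift h \<theta> x (- g), x}"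

definition P_form ::
    "real \<Rightarrow> real \<Rightarrow> real \<times> real \<Rightarrow> int \<times> int \<Rightarrow> int \<times> int \<Rightarrow> int \<times> int
      \<Rightarrow> (real \<times> real \<Rightarrow> real) \<Rightarrow> real" where
  "P_form h \<theta> x e f g u =
     u (shift h \<theta> x e) - u (shift h \<theta> x f) - u (shift h \<theta> x g) + u x"

definition V_max ::
    "real \<Rightarrow> real \<Rightarrow> (real \<times> real) set \<Rightarrow> real \<times> real \<Rightarrow> (int \<times> int) set" where
  "V_max h \<theta> X x = {e. irreducible_vec e \<and> shift h \<theta> x e \<in> X}"

text \<open>
  A family indexed by \<open>X\<close> is a total function that is empty outside \<open>X\<close>, so that the pointwise
  order on functions is the inclusion of families.  \<open>convex_cone hull {}\<close> is \<open>{0}\<close>.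
\<close>

definition stencil_family ::
    "real \<Rightarrow> real \<Rightarrow> (real \<times> real) set \<Rightarrow> (real \<times> real \<Rightarrow> (int \<times> int) set) \<Rightarrow> bool" where
  "stencil_family h \<theta> X V \<longleftrightarrow>
     (\<forall>x. x \<notin> X \<longrightarrow> V x = {}) \<and>
     (\<forall>x\<in>X. V x \<subseteq> V_max h \<theta> X x \<and>
        (\<forall>e\<in>V x. \<forall>f g. parents e f g \<longrightarrow> {f, g} \<inter> V_max h \<theta> X x \<subseteq> V x) \<and>
        convex_cone hull (real_vec ` V x) = convex_cone hull (real_vec ` V_max h \<theta> X x))"

definition candidates ::
    "real \<Rightarrow> real \<Rightarrow> (real \<times> real) set \<Rightarrow> (real \<times> real \<Rightarrow> (int \<times> int) set)
      \<Rightarrow> real \<times> real \<Rightarrow> (int \<times> int) set" where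
  "candidates h \<theta> X V x =
     {e \<in> V_max h \<theta> X x - V x. \<exists>f g. parents e f g \<and> f \<in> V x \<and> g \<in> V x}"

text \<open>
  The cone \<open>Conv(V)\<close>.  Its elements are total functions here, but only their values on \<open>X\<close>
  matter, since every form below is supported in \<open>X\<close>.
\<close>

definition Conv_stencils ::
    "real \<Rightarrow> real \<Rightarrow> (real \<times> real) set \<Rightarrow> (real \<times> real \<Rightarrow> (int \<times> int) set)
      \<Rightarrow> (real \<times> real \<Rightarrow> real) set" where
  "Conv_stencils h \<theta> X V = {u. \<forall>x\<in>X.
     (\<forall>e\<in>V x. S_support h \<theta> x e \<subseteq> X \<longrightarrow> S_form h \<theta> x e u \<ge> 0) \<and>
     (\<forall>e\<in>V x. \<forall>f g. parents e f g \<longrightarrow> T_support h \<theta> x e f g \<subseteq> X \<longrightarrow> T_form h \<theta> x e f g u \<ge> 0) \<and>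
     (\<forall>e\<in>candidates h \<theta> X V x. \<forall>f g. parents e f g \<longrightarrow> P_form h \<theta> x e f g u \<ge> 0)}"

definition minimal_stencils ::
    "real \<Rightarrow> real \<Rightarrow> (real \<times> real) set \<Rightarrow> (real \<times> real \<Rightarrow> real)
      \<Rightarrow> real \<times> real \<Rightarrow> (int \<times> int) set" where
  "minimal_stencils h \<theta> X u =
     (LEAST V. stencil_family h \<theta> X V \<and> u \<in> Conv_stencils h \<theta> X V)"

definition stencils_card ::
    "(real \<times> real) set \<Rightarrow> (real \<times> real \<Rightarrow> (int \<times> int) set) \<Rightarrow> nat" where
  "stencils_card X V = (\<Sum>x\<in>X. card (V x))"

end

theory Submission
  imports Defs
begin

text \<open>
Fix a grid point \<open>x\<close> and put \<open>\<phi> v = U (x + h R v)\<close>, a convex function on the convex set \<open>K\<close> of those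
\<open>v\<close> for which it is defined.  Call a direction \<open>e = f + g\<close> with parents \<open>f\<close>, \<open>g\<close> superfluous if
\<open>f, g \<in> K\<close> and \<open>\<phi> f + \<phi> g \<le> \<phi> e + \<phi> 0\<close>, and call an irreducible \<open>e \<in> K\<close> necessary if it is not
superfluous.

\<^emph>\<open>The minimal stencils are the necessary directions.\<close>  By convexity along lines a child of a superfluous
vector is superfluous (\<open>superfluous_child\<close>).  Hence the necessary directions are stable under parents, a
superfluous vector lies in the cone of necessary ones, and the candidates for refinement are
superfluous.  Conversely, let \<open>e \<in> K\<close> be irreducible and missing from the stencil at \<open>x\<close> of a
family whose cone contains \<open>U\<close>.  If a parent of \<open>e\<close> were not
in \<open>K\<close>, stability would confine the stencil to a half-plane that does not contain \<open>e\<close>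
(\<open>parent_in_K\<close>), against visibility; so both parents are in \<open>K\<close>.  If the stencil contains both
then \<open>e\<close> is a candidate, and if it omits one then that parent is superfluous by induction; either way
\<open>e\<close> is superfluous (\<open>necessary_subset\<close>, \<open>minimal_stencils_eq\<close>).

\<^emph>\<open>Each direction is needed for few angles.\<close>  Let \<open>m\<close> be the midpoint of \<open>x\<close> and \<open>x \<oplus> e\<close>.  It is also
the midpoint of \<open>x \<oplus> f\<close> and \<open>x \<oplus> g\<close>, so the necessity of \<open>e\<close> says that the even convex function
\<open>W v = U (m + v) + U (m - v)\<close>, set to \<open>\<infinity>\<close> where it is not defined, takes a larger value at
\<open>h R (f - g) / 2\<close> than at \<open>h R e / 2\<close>.  Keep \<open>m\<close> and rotate.  If this happens for two angles,
the sublevel set of \<open>W\<close> at the larger of the two values at \<open>h R e / 2\<close> contains a rectangle with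
these points as vertices, and avoids one of the points \<open>h R (f - g) / 2\<close>.  This forces the angles to be within
\<open>4 / (\<parallel>f\<parallel> \<parallel>g\<parallel>)\<close> of each other (\<open>flip_angles_close\<close>,
\<open>nn_integral_flip_angles_basis_le\<close>).  A parent outside \<open>K\<close> is the case of the value
\<open>\<infinity>\<close>, so the directions that the shape of \<open>\<Omega>\<close> forces into the stencil are counted in the same way.

\<^emph>\<open>Summation.\<close>  Averaging over \<open>\<xi>\<close> turns the sum over grid points into \<open>h\<^sup>-\<^sup>2\<close> times an integral over
the plane, and for each fixed angle the passage from \<open>x\<close> to \<open>m\<close> is a translation.  The average is thus at most \<open>|\<Omega>| / h\<^sup>2\<close>
times a constant plus the sum of \<open>8 / (\<parallel>f\<parallel> \<parallel>g\<parallel>)\<close> over the direct acute bases whose vectors have length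
at most \<open>R = diam \<Omega> / h\<close>.  For given \<open>f\<close> the possible \<open>g\<close> form an arithmetic progression of step \<open>f\<close>, so
those longer than \<open>f\<close> contribute \<open>O(ln R / \<parallel>f\<parallel>\<^sup>2)\<close>; summing over \<open>f\<close> gives another logarithm
(\<open>sum_bases_upto_le_ln\<close>).
\<close>

section \<open>Bases of the lattice and parents\<close>

definition dot2 :: "int \<times> int \<Rightarrow> int \<times> int \<Rightarrow> int" where
  "dot2 f g = fst f * fst g + snd f * snd g"

definition comb2 :: "int \<Rightarrow> int \<times> int \<Rightarrow> int \<Rightarrow> int \<times> int \<Rightarrow> int \<times> int" where
  "comb2 a f b g = (a * fst f + b * fst g, a * snd f + b * snd g)"

lemma real_vec_add: "real_vec (f + g) = real_vec f + real_vec g"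
  by (simp add: real_vec_def)

lemma real_vec_uminus: "real_vec (- f) = - real_vec f"
  by (simp add: real_vec_def)

lemma real_vec_comb2: "real_vec (comb2 a f b g) = of_int a *\<^sub>R real_vec f + of_int b *\<^sub>R real_vec g"
  by (simp add: real_vec_def comb2_def)

lemma inner_real_vec: "real_vec f \<bullet> real_vec g = of_int (dot2 f g)"
  by (simp add: real_vec_def dot2_def)

lemma norm_real_vec: "norm (real_vec e) = sqrt (of_int (dot2 e e))"
  by (simp add: norm_eq_sqrt_inner inner_real_vec)

lemma norm_real_vec_gt_1: "norm (real_vec e) > 1 \<longleftrightarrow> dot2 e e > 1"
  by (simp add: norm_real_vec)

lemma dot2_add: "dot2 (f + g) k = dot2 f k + dot2 g k" "dot2 k (f + g) = dot2 k f + dot2 k g"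
  by (simp_all add: dot2_def algebra_simps)

lemma dot2_commute: "dot2 f g = dot2 g f"
  by (simp add: dot2_def algebra_simps)

lemma dot2_self_nonneg: "dot2 f f \<ge> 0"
  by (simp add: dot2_def)

lemma dot2_self_eq_0: "dot2 f f = 0 \<longleftrightarrow> f = 0"
  by (simp add: dot2_def prod_eq_iff sum_power2_eq_zero_iff power2_eq_square[symmetric])

lemma dot2_self_pos: "f \<noteq> 0 \<Longrightarrow> dot2 f f \<ge> 1"
  using dot2_self_nonneg[of f] dot2_self_eq_0[of f] by linarith

lemma det2_swap: "det2 f g = - det2 g f"
  by (simp add: det2_def)

lemma det2_dot2_sq: "(det2 f g)\<^sup>2 + (dot2 f g)\<^sup>2 = dot2 f f * dot2 g g"
  by (simp add: det2_def dot2_def power2_eq_square algebra_simps)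

text \<open>
Irreducibility and length more than 1 come for free: a common divisor of the entries of \<open>f + g\<close>
divides \<open>det2 f g\<close>, and both \<open>f\<close> and \<open>g\<close> are nonzero.
\<close>

lemma parents_iff: "parents e f g \<longleftrightarrow> det2 f g = 1 \<and> dot2 f g \<ge> 0 \<and> e = f + g"
proof -
  have "irreducible_vec (f + g) \<and> dot2 (f + g) (f + g) > 1" if "det2 f g = 1" "dot2 f g \<ge> 0"
  proof
    have "gcd (fst (f + g)) (snd (f + g)) dvd fst (f+g) * snd g - snd (f+g) * fst g"
      by (intro dvd_diff dvd_mult2) auto
    also have "fst (f+g) * snd g - snd (f+g) * fst g = det2 f g"
      by (simp add: det2_def algebra_simps)
    finally show "irreducible_vec (f + g)"
      using that by (simp add: irreducible_vec_def)
    have "f \<noteq> 0" "g \<noteq> 0" using that by (auto simp: det2_def)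
    then show "dot2 (f + g) (f + g) > 1"
      using dot2_self_pos[of f] dot2_self_pos[of g] that by (simp add: dot2_add dot2_commute)
  qed
  then show ?thesis
    by (auto simp: parents_def direct_acute_basis_def inner_real_vec norm_real_vec_gt_1)
qed

lemma irreducible_det2_1:
  assumes "\<bar>det2 f g\<bar> = 1" shows "irreducible_vec f" "irreducible_vec g"
proof -
  have "gcd (fst f) (snd f) dvd det2 f g"  "gcd (fst g) (snd g) dvd det2 f g"
    unfolding det2_def by (auto intro!: dvd_diff dvd_mult dvd_mult2)
  then have "gcd (fst f) (snd f) dvd \<bar>det2 f g\<bar>" "gcd (fst g) (snd g) dvd \<bar>det2 f g\<bar>"
    by (simp_all only: dvd_abs_iff)
  then show "irreducible_vec f" "irreducible_vec g"
    by (simp_all add: irreducible_vec_def assms)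
qed

text \<open>
Cramer's rule.  The sign \<open>s\<close> lets one statement cover both orientations of a basis.
\<close>

lemma comb2_det2_coords:
  assumes "det2 f g = s" "s * s = 1"
  shows "v = comb2 (s * det2 v g) f (s * det2 f v) g"
proof -
  have "s * (fst f * snd g - snd f * fst g) = 1" using assms by (simp add: det2_def)
  then have "fst v = fst v * (s * (fst f * snd g - snd f * fst g))" 
     "snd v = snd v * (s * (fst f * snd g - snd f * fst g))" by auto
  then show ?thesis
    by (auto simp: comb2_def prod_eq_iff det2_def algebra_simps)
qed

lemma coprime_coords:
  assumes "irreducible_vec (comb2 a f b g)" shows "coprime a b"
proof (rule coprimeI)
  fix c assume "c dvd a" "c dvd b"
  then have "c dvd gcd (fst (comb2 a f b g)) (snd (comb2 a f b g))"
    by (simp add: comb2_def)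
  also have "\<dots> = 1" using assms by (simp only: irreducible_vec_def)
  finally show "is_unit c" .
qed

text \<open>
The two parents of the fraction \<open>b / a\<close> in the Stern-Brocot tree, found by running the subtractive Euclidean
algorithm: both matrices that send \<open>(a, b)\<close> to \<open>(a + b, b)\<close> and \<open>(a, a + b)\<close> have determinant 1.
\<close>

lemma coprime_mediant:
  fixes a b :: int
  assumes "a \<ge> 1" "b \<ge> 1" "coprime a b"
  shows "\<exists>a1 b1 a2 b2. a1 \<ge> 0 \<and> b1 \<ge> 0 \<and> a2 \<ge> 0 \<and> b2 \<ge> 0 \<and>
           a = a1 + a2 \<and> b = b1 + b2 \<and> a1 * b2 - a2 * b1 = 1"
  using assms
proof (induction "nat (a + b)" arbitrary: a b rule: less_induct)
  case less
  consider "a = b" | "a < b" | "b < a" by linarith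
  then show ?case
  proof cases
    case 1
    then have "a = 1" using less.prems by simp
    then show ?thesis using 1 by (intro exI[of _ 1] exI[of _ 0]) auto
  next
    case 2
    have "gcd (b - a) a = 1" using less.prems(3) gcd_diff1[of b a] by (simp add: gcd.commute)
    then have "coprime a (b - a)" by (simp add: coprime_iff_gcd_eq_1 gcd.commute)
    moreover have "nat (a + (b - a)) < nat (a + b)" "b - a \<ge> 1" using 2 less.prems by auto
    ultimately obtain a1 b1 a2 b2 where
      *: "a1 \<ge> 0" "b1 \<ge> 0" "a2 \<ge> 0" "b2 \<ge> 0" "a = a1 + a2" "b - a = b1 + b2" "a1 * b2 - a2 * b1 = 1"
      using less.hyps[of a "b - a"] less.prems(1) by blast
    show ?thesis
      by (rule exI[of _ a1], rule exI[of _ "a1 + b1"], rule exI[of _ a2], rule exI[of _ "a2 + b2"])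
         (use * in \<open>auto simp: algebra_simps\<close>)
  next
    case 3
    have "gcd (a - b) b = 1" using less.prems(3) gcd_diff1[of a b] by simp
    then have "coprime (a - b) b" by (simp add: coprime_iff_gcd_eq_1)
    moreover have "nat ((a - b) + b) < nat (a + b)" "a - b \<ge> 1" using 3 less.prems by auto
    ultimately obtain a1 b1 a2 b2 where
      *: "a1 \<ge> 0" "b1 \<ge> 0" "a2 \<ge> 0" "b2 \<ge> 0" "a - b = a1 + a2" "b = b1 + b2" "a1 * b2 - a2 * b1 = 1"
      using less.hyps[of "a - b" b] less.prems(2) by blast
    show ?thesis
      by (rule exI[of _ "a1 + b1"], rule exI[of _ b1], rule exI[of _ "a2 + b2"], rule exI[of _ b2])
         (use * in \<open>auto simp: algebra_simps\<close>)
  qed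
qed

text \<open>
The descendants of an acute basis \<open>f\<close>, \<open>g\<close> are the irreducible vectors strictly inside its cone: their
parents stay in the closed cone.  Which of the two parents comes first depends on the orientation of
\<open>f\<close>, \<open>g\<close>.
\<close>

lemma parents_in_cone:
  assumes "\<bar>det2 f g\<bar> = 1" "dot2 f g \<ge> 0" "a \<ge> 1" "b \<ge> 1" "coprime a b"
  obtains a1 b1 a2 b2 where "a1 \<ge> 0" "b1 \<ge> 0" "a2 \<ge> 0" "b2 \<ge> 0"
    "a = a1 + a2" "b = b1 + b2" "a1 * b2 - a2 * b1 = 1"
    "parents (comb2 a f b g) (comb2 a1 f b1 g) (comb2 a2 f b2 g) \<or>
     parents (comb2 a f b g) (comb2 a2 f b2 g) (comb2 a1 f b1 g)"
proof -
  obtain a1 b1 a2 b2 where *: "a1 \<ge> 0" "b1 \<ge> 0" "a2 \<ge> 0" "b2 \<ge> 0"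
    "a = a1 + a2" "b = b1 + b2" "a1 * b2 - a2 * b1 = 1"
    using coprime_mediant assms(3-5) by blast
  let ?p = "comb2 a1 f b1 g" and ?q = "comb2 a2 f b2 g"
  have "det2 ?p ?q = (a1 * b2 - a2 * b1) * det2 f g"
    by (simp add: det2_def comb2_def algebra_simps)
  then have d: "\<bar>det2 ?p ?q\<bar> = 1" using * assms(1) by simp
  have "dot2 ?p ?q = a1 * a2 * dot2 f f + b1 * b2 * dot2 g g + (a1 * b2 + a2 * b1) * dot2 f g"
    by (simp add: dot2_def comb2_def algebra_simps)
  then have "dot2 ?p ?q \<ge> 0" using * assms(2) by (simp add: dot2_self_nonneg)
  moreover have "comb2 a f b g = ?p + ?q" "comb2 a f b g = ?q + ?p"
    using * by (auto simp: comb2_def algebra_simps)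
  moreover have "det2 ?p ?q = 1 \<or> det2 ?q ?p = 1"
    using d det2_swap[of ?p ?q] by linarith
  ultimately have "parents (comb2 a f b g) ?p ?q \<or> parents (comb2 a f b g) ?q ?p"
    by (auto simp: parents_iff dot2_commute)
  then show ?thesis using that * by blast
qed

text \<open>
A vector that is not a unit vector lies strictly inside a quadrant, the cone of an acute basis.
\<close>

lemma unit_or_parents:
  assumes "irreducible_vec e"
  shows "e \<in> {(1,0),(-1,0),(0,1),(0,-1)} \<or> (\<exists>f g. parents e f g)"
proof -
  obtain x y where e: "e = (x, y)" by force
  have c: "gcd x y = 1" using assms by (simp add: irreducible_vec_def e)
  show ?thesis
  proof (cases "x = 0 \<or> y = 0")
    case True
    then show ?thesis using c e by auto
  next
    case False
    have e': "e = comb2 \<bar>x\<bar> (sgn x, 0) \<bar>y\<bar> (0, sgn y)"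
      by (simp add: e comb2_def mult.commute[of "\<bar>_\<bar>"] sgn_mult_abs)
    have "\<bar>det2 (sgn x, 0) (0, sgn y)\<bar> = 1" "dot2 (sgn x, 0) (0, sgn y) \<ge> 0"
      using False by (auto simp: det2_def dot2_def abs_mult abs_sgn_eq)
    moreover have "\<bar>x\<bar> \<ge> 1" "\<bar>y\<bar> \<ge> 1" "coprime \<bar>x\<bar> \<bar>y\<bar>"
      using False c by (auto simp: coprime_iff_gcd_eq_1)
    ultimately obtain p q where "parents e p q \<or> parents e q p"
      by (rule parents_in_cone) (use e' in blast)
    then show ?thesis by blast
  qed
qed

text \<open>
Both first parents have determinant 1 with \<open>e\<close>, so they differ by a multiple \<open>k\<close> of \<open>e\<close>; any
\<open>k \<noteq> 0\<close> makes the inner product of the new pair negative.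
\<close>

lemma parents_unique:
  assumes "parents e f g" "parents e f' g'" shows "f' = f \<and> g' = g"
proof -
  define k where "k = det2 f f'"
  have a: "det2 f g = 1" "dot2 f g \<ge> 0" "e = f + g" "det2 f' g' = 1" "dot2 f' g' \<ge> 0" "e = f' + g'"
    using assms by (auto simp: parents_iff)
  have g': "g' = f + g - f'" using a by (metis add_diff_cancel_left')
  have "det2 f' g' = det2 f' f + det2 f' g" unfolding g' by (simp add: det2_def algebra_simps)
  then have "det2 f' g = 1 + k" using a det2_swap[of f' f] by (simp add: k_def)
  then have f': "f' = comb2 (1 + k) f k g"
    using comb2_det2_coords[of f g 1 f'] a by (simp add: k_def)
  have g'': "g' = comb2 (- k) f (1 - k) g"
    unfolding g' f' by (auto simp: comb2_def prod_eq_iff algebra_simps)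
  have dot: "dot2 f' g' = (1 - 2 * (k * k)) * dot2 f g - (k * k + k) * dot2 f f - (k * k - k) * dot2 g g"
    unfolding f' g'' by (simp add: comb2_def dot2_def algebra_simps)
  have "f \<noteq> 0" "g \<noteq> 0" using a by (auto simp: det2_def)
  then have p: "dot2 f f \<ge> 1" "dot2 g g \<ge> 1" by (auto simp: dot2_self_pos)
  have k: "k = 0"
  proof -
    have False if "k \<noteq> 0"
    proof -
      have k1: "k * k \<ge> \<bar>k\<bar>" "\<bar>k\<bar> \<ge> 1"
        using that mult_right_mono[of 1 "\<bar>k\<bar>" "\<bar>k\<bar>"] by (auto simp: abs_mult_self_eq)
      have "(1 - 2 * (k * k)) * dot2 f g \<le> 0"
        by (rule mult_nonpos_nonneg) (use k1 a(2) in linarith)+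
      moreover have "k * k + k \<ge> 0" "k * k - k \<ge> 0" "(k * k + k) + (k*k - k) \<ge> 1"
        using k1 by linarith+
      moreover have "k * k + k \<le> (k * k + k) * dot2 f f"
        using mult_left_mono[OF p(1) \<open>k * k + k \<ge> 0\<close>] by simp
      moreover have "k * k - k \<le> (k * k - k) * dot2 g g"
        using mult_left_mono[OF p(2) \<open>k * k - k \<ge> 0\<close>] by simp
      ultimately show False using a(5) unfolding dot by linarith
    qed
    then show ?thesis by blast
  qed
  show ?thesis using f' g'' k by (auto simp: comb2_def)
qed

lemma dot2_self_gt_parents:
  assumes "parents e f g" shows "dot2 f f < dot2 e e" "dot2 g g < dot2 e e"
proof -
  have a: "det2 f g = 1" "dot2 f g \<ge> 0" "e = f + g" using assms by (auto simp: parents_iff)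
  moreover have "f \<noteq> 0" "g \<noteq> 0" using a by (auto simp: det2_def)
  ultimately show "dot2 f f < dot2 e e" "dot2 g g < dot2 e e"
    using dot2_self_pos[of f] dot2_self_pos[of g] by (auto simp: dot2_add dot2_commute)
qed

lemma irreducible_parents:
  assumes "parents e f g" shows "irreducible_vec e" "irreducible_vec f" "irreducible_vec g"
  using assms irreducible_det2_1[of f g] parents_iff[of e f g] by (auto simp: parents_def)

section \<open>Convex functions on the lattice and necessary directions\<close>

lemma convex_triangle:
  assumes "convex C" "0 \<in> C" "a \<in> C" "b \<in> C" "s \<ge> 0" "t \<ge> 0" "s + t \<le> 1"
  shows "s *\<^sub>R a + t *\<^sub>R b \<in> C"
proof -
  have "(s + t) *\<^sub>R ((s / (s + t)) *\<^sub>R a + (t / (s + t)) *\<^sub>R b) + (1 - (s + t)) *\<^sub>R 0 \<in> C"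
    if "s + t > 0"
  proof (rule convexD[OF assms(1) _ assms(2)])
    show "(s / (s + t)) *\<^sub>R a + (t / (s + t)) *\<^sub>R b \<in> C"
      by (rule convexD[OF assms(1)]) (use assms that in \<open>auto simp flip: add_divide_distrib\<close>)
  qed (use assms that in auto)
  moreover have "s = 0 \<and> t = 0" if "\<not> s + t > 0" using assms(5,6) that by linarith
  ultimately show ?thesis using assms(2)
    by (cases "s + t > 0") (auto simp: scaleR_add_right)
qed

text \<open>
For \<open>\<phi> v = u (x + h R v)\<close> the inequality is \<open>P_form \<ge> 0\<close> at \<open>x\<close>, the value \<open>\<phi> 0\<close> being \<open>u x\<close>.
\<close>

definition superfluous :: "(real \<times> real) set \<Rightarrow> (real \<times> real \<Rightarrow> real) \<Rightarrow> int \<times> int \<Rightarrow> bool" where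
  "superfluous K \<phi> e \<longleftrightarrow> (\<exists>f g. parents e f g \<and> real_vec f \<in> K \<and> real_vec g \<in> K \<and>
     \<phi> (real_vec f) + \<phi> (real_vec g) \<le> \<phi> (real_vec e) + \<phi> 0)"

lemma superfluousI:
  assumes "parents e f g" "real_vec f \<in> K" "real_vec g \<in> K"
    "\<phi> (real_vec f) + \<phi> (real_vec g) \<le> \<phi> (real_vec e) + \<phi> 0"
  shows "superfluous K \<phi> e"
  using assms unfolding superfluous_def by blast

text \<open>
Two points placed symmetrically on a chord lie no higher in total than its ends.  This is the form in
which the monotonicity of slopes along a line is used.
\<close>

lemma convex_on_swap_chord:
  assumes "convex_on K \<phi>" "y \<in> K" "z \<in> K" "0 \<le> s" "s \<le> 1"
  shows "\<phi> ((1 - s) *\<^sub>R y + s *\<^sub>R z) + \<phi> (s *\<^sub>R y + (1 - s) *\<^sub>R z) \<le> \<phi> y + \<phi> z"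
proof -
  have "\<phi> ((1 - s) *\<^sub>R y + s *\<^sub>R z) \<le> (1 - s) * \<phi> y + s * \<phi> z"
    using convex_onD[OF assms(1), of s y z] assms by auto
  moreover have "\<phi> (s *\<^sub>R y + (1 - s) *\<^sub>R z) \<le> s * \<phi> y + (1 - s) * \<phi> z"
    using convex_onD[OF assms(1), of "1 - s" y z] assms by auto
  ultimately show ?thesis by (simp add: algebra_simps)
qed

text \<open>
Slopes along a line increase.  In the direction \<open>g\<close>, the increment over the last step to
\<open>p + (j + 1) g\<close> is at least \<open>\<phi> (p + g) - \<phi> p\<close>; in the direction \<open>p\<close>, the increment
from \<open>g\<close> to \<open>p + g\<close> is at least the one from \<open>q\<close> to \<open>g\<close>.
\<close>

lemma flat_parallelogram_extends:
  fixes p q :: "'a::real_vector" and j :: real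
  defines "g \<equiv> p + q"
  assumes \<phi>: "convex_on K \<phi>" and K: "0 \<in> K" "p \<in> K" "q \<in> K" "g \<in> K" "p + (j + 1) *\<^sub>R g \<in> K"
    and j: "j \<ge> 0" and flat: "\<phi> p + \<phi> q \<le> \<phi> g + \<phi> 0"
  shows "p + j *\<^sub>R g \<in> K" "\<phi> (p + j *\<^sub>R g) + \<phi> g \<le> \<phi> (p + (j + 1) *\<^sub>R g) + \<phi> 0"
proof -
  define e where "e = p + (j + 1) *\<^sub>R g"
  define s where "s = 1 / (j + 1)"
  have s: "0 \<le> s" "s \<le> 1" "s * (j + 1) = 1" using j by (auto simp: s_def)
  have "(1 - s) *\<^sub>R p + s *\<^sub>R e = p + (s * (j + 1)) *\<^sub>R g"
    by (simp add: e_def algebra_simps)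
  then have 1: "(1 - s) *\<^sub>R p + s *\<^sub>R e = p + g" using s by simp
  have "s *\<^sub>R p + (1 - s) *\<^sub>R e = p + (j + 1 - s * (j + 1)) *\<^sub>R g"
    by (simp add: e_def algebra_simps)
  then have 2: "s *\<^sub>R p + (1 - s) *\<^sub>R e = p + j *\<^sub>R g" using s by simp
  have cK: "convex K" using \<phi> by (rule convex_on_imp_convex)
  have e: "e \<in> K" using K by (simp add: e_def)
  show "p + j *\<^sub>R g \<in> K"
    using convexD[OF cK K(2) e, of s "1 - s"] s 2 by simp
  have pg: "p + g \<in> K"
    using convexD[OF cK K(2) e, of "1 - s" s] s 1 by simp
  have "\<phi> (p + g) + \<phi> (p + j *\<^sub>R g) \<le> \<phi> p + \<phi> e"
    using convex_on_swap_chord[OF \<phi> K(2) e s(1,2)] 1 2 by simp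
  moreover have "(1/2) *\<^sub>R q + (1/2) *\<^sub>R (p + g) = g"
    unfolding g_def by (simp add: scaleR_add_right flip: scaleR_add_left) (simp add: algebra_simps flip: scaleR_add_left)
  then have "\<phi> g + \<phi> g \<le> \<phi> q + \<phi> (p + g)"
    using convex_on_swap_chord[OF \<phi> K(3) pg, of "1/2"] by simp
  ultimately show "\<phi> (p + j *\<^sub>R g) + \<phi> g \<le> \<phi> (p + (j + 1) *\<^sub>R g) + \<phi> 0"
    using flat by (simp add: e_def)
qed

text \<open>
A child of \<open>g\<close> whose other parent \<open>f\<close> lies to the right of \<open>g\<close> is reached from the right parent \<open>p\<close> of
\<open>g\<close> by adding \<open>g\<close> repeatedly; a negative number of steps would make the angle between \<open>f\<close> and \<open>g\<close>
obtuse.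
\<close>

lemma parents_of_parent:
  assumes "parents e f g" "parents g p q"
  obtains j where "j \<ge> 0" "real_vec f = real_vec p + of_int j *\<^sub>R real_vec g"
proof -
  have a: "det2 f g = 1" "dot2 f g \<ge> 0" "det2 p q = 1" "dot2 p q \<ge> 0" "g = p + q"
    using assms by (auto simp: parents_iff)
  define j where "j = det2 p f"
  have "det2 f q = 1 + j" using a by (simp add: j_def det2_def algebra_simps)
  then have f: "f = comb2 (1 + j) p j q"
    using comb2_det2_coords[of p q 1 f] a by (simp add: j_def)
  have "j \<ge> 0"
  proof (rule ccontr)
    assume "\<not> j \<ge> 0"
    then have j: "1 + j \<le> 0" "1 + 2 * j \<le> 0" "j \<le> -1" by auto
    have "q \<noteq> 0" using a by (auto simp: det2_def)
    then have "dot2 q q \<ge> 1" by (rule dot2_self_pos)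
    moreover have "dot2 f g = (1 + j) * dot2 p p + j * dot2 q q + (1 + 2 * j) * dot2 p q"
      unfolding f a(5) by (simp add: dot2_def comb2_def algebra_simps)
    moreover have "(1 + j) * dot2 p p \<le> 0" "(1 + 2 * j) * dot2 p q \<le> 0"
      using j a(4) by (auto intro!: mult_nonpos_nonneg dot2_self_nonneg)
    moreover have "j * dot2 q q \<le> -1 * dot2 q q"
      using j \<open>dot2 q q \<ge> 1\<close> by (intro mult_right_mono) auto
    ultimately show False using a(2) by linarith
  qed
  moreover have "real_vec f = real_vec p + of_int j *\<^sub>R real_vec g"
    unfolding f a(5) real_vec_comb2 real_vec_add by (simp add: algebra_simps)
  ultimately show ?thesis using that by blast
qed

text \<open>
The mirror image, with the roles of left and right exchanged.
\<close>

lemma parents_of_parent':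
  assumes "parents e f g" "parents f p q"
  obtains j where "j \<ge> 0" "real_vec g = real_vec q + of_int j *\<^sub>R real_vec f"
proof -
  \<comment> \<open>Reflection in the first axis reverses orientation, so it exchanges the two parents.\<close>
  define m where "m v = (fst v, - snd v :: int)" for v :: "int \<times> int"
  have m: "parents (m e) (m g) (m f)" "parents (m f) (m q) (m p)"
    using assms by (auto simp: parents_iff m_def det2_def dot2_def algebra_simps)
  from parents_of_parent[OF this] obtain j where
    "j \<ge> 0" "real_vec (m g) = real_vec (m q) + of_int j *\<^sub>R real_vec (m f)" by blast
  then show ?thesis using that[of j] by (auto simp: m_def real_vec_def)
qed

text \<open>
This is where the hierarchy of parents fits convexity: the chain from a parent of \<open>k\<close> to \<open>e\<close> runs on a
line in the direction of \<open>k\<close>.  The other parent of \<open>e\<close> then lies in \<open>K\<close> automatically, since it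
is on the segment from that parent of \<open>k\<close> to \<open>e\<close>.
\<close>

lemma superfluous_child:
  assumes \<phi>: "convex_on K \<phi>" and K: "0 \<in> K" "real_vec e \<in> K" "real_vec k \<in> K"
    and e: "parents e f g" and k: "k = f \<or> k = g" and sup: "superfluous K \<phi> k"
  shows "superfluous K \<phi> e"
proof -
  obtain p q where pq: "parents k p q" "real_vec p \<in> K" "real_vec q \<in> K"
    "\<phi> (real_vec p) + \<phi> (real_vec q) \<le> \<phi> (real_vec k) + \<phi> 0"
    using sup by (auto simp: superfluous_def)
  have kpq: "real_vec k = real_vec p + real_vec q"
    using pq(1) by (auto simp: parents_iff real_vec_add)
  have efg: "real_vec e = real_vec f + real_vec g"
    using e by (auto simp: parents_iff real_vec_add)
  from k show ?thesis
  proof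
    assume [simp]: "k = g"
    obtain j where j: "j \<ge> 0" "real_vec f = real_vec p + of_int j *\<^sub>R real_vec g"
      using parents_of_parent[OF e pq(1)[unfolded \<open>k = g\<close>]] by blast
    have ee: "real_vec e = real_vec p + (of_int j + 1) *\<^sub>R real_vec g"
      unfolding efg j(2) by (simp add: algebra_simps)
    note * = flat_parallelogram_extends[OF \<phi> K(1) pq(2,3), of "of_int j",
        folded kpq, unfolded \<open>k = g\<close>, folded ee j(2)]
    have "real_vec f \<in> K" "\<phi> (real_vec f) + \<phi> (real_vec g) \<le> \<phi> (real_vec e) + \<phi> 0"
      using * K pq(4) j(1) by auto
    then show ?thesis using superfluousI[OF e] K(3) by simp
  next
    assume [simp]: "k = f"
    obtain j where j: "j \<ge> 0" "real_vec g = real_vec q + of_int j *\<^sub>R real_vec f"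
      using parents_of_parent'[OF e pq(1)[unfolded \<open>k = f\<close>]] by blast
    have ee: "real_vec e = real_vec q + (of_int j + 1) *\<^sub>R real_vec f"
      unfolding efg j(2) by (simp add: algebra_simps)
    have kqp: "real_vec k = real_vec q + real_vec p" using kpq by (simp add: add.commute)
    note * = flat_parallelogram_extends[OF \<phi> K(1) pq(3,2), of "of_int j",
        folded kqp, unfolded \<open>k = f\<close>, folded ee j(2)]
    have "real_vec g \<in> K" "\<phi> (real_vec f) + \<phi> (real_vec g) \<le> \<phi> (real_vec e) + \<phi> 0"
      using * K pq(4) j(1) by (auto simp: add.commute)
    then show ?thesis using superfluousI[OF e] K(3) by simp
  qed
qed

definition necessary :: "(real \<times> real) set \<Rightarrow> (real \<times> real \<Rightarrow> real) \<Rightarrow> (int \<times> int) set" where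
  "necessary K \<phi> = {e. irreducible_vec e \<and> real_vec e \<in> K \<and> \<not> superfluous K \<phi> e}"

lemma necessary_stable:
  assumes "convex_on K \<phi>" "0 \<in> K" "e \<in> necessary K \<phi>" "parents e f g" "k = f \<or> k = g" "real_vec k \<in> K"
  shows "k \<in> necessary K \<phi>"
  using assms superfluous_child[of K \<phi> e k f g] irreducible_parents[OF assms(4)]
  by (auto simp: necessary_def)

text \<open>
A superfluous vector is the sum of its parents, which are in \<open>K\<close> and shorter.
\<close>

lemma necessary_visible:
  assumes "irreducible_vec e" "real_vec e \<in> K"
  shows "real_vec e \<in> convex_cone hull (real_vec ` necessary K \<phi>)"
  using assms
proof (induction "nat (dot2 e e)" arbitrary: e rule: less_induct)
  case less
  show ?case
  proof (cases "e \<in> necessary K \<phi>")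
    case True
    then show ?thesis by (simp add: hull_inc)
  next
    case False
    then obtain f g where *: "parents e f g" "real_vec f \<in> K" "real_vec g \<in> K"
      using less.prems by (auto simp: necessary_def superfluous_def)
    have "real_vec f \<in> convex_cone hull (real_vec ` necessary K \<phi>)"
         "real_vec g \<in> convex_cone hull (real_vec ` necessary K \<phi>)"
      using less.hyps[of f] less.hyps[of g] * dot2_self_gt_parents[OF *(1)]
        irreducible_parents[OF *(1)] dot2_self_nonneg[of e] dot2_self_nonneg[of f] dot2_self_nonneg[of g] by auto
    then show ?thesis
      using *(1) by (auto simp: parents_iff real_vec_add intro: convex_cone_hull_add)
  qed
qed

text \<open>
The stencil of an arbitrary family at one grid point, seen in lattice coordinates.
\<close>

locale lattice_stencil =
  fixes K :: "(real \<times> real) set" and V :: "(int \<times> int) set"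
  assumes convex: "convex K" and zero: "0 \<in> K"
    and irreducible: "v \<in> V \<Longrightarrow> irreducible_vec v" and in_K: "v \<in> V \<Longrightarrow> real_vec v \<in> K"
    and stable: "v \<in> V \<Longrightarrow> parents v f g \<Longrightarrow> k = f \<or> k = g \<Longrightarrow> real_vec k \<in> K \<Longrightarrow> k \<in> V"
    and visible: "irreducible_vec e \<Longrightarrow> real_vec e \<in> K \<Longrightarrow> real_vec e \<in> convex_cone hull (real_vec ` V)"
begin

text \<open>
Walk up the tree from the descendant \<open>v = a f + b e\<close> towards \<open>e\<close>.  The parent \<open>q\<close> of \<open>v\<close> on the side of \<open>e\<close>
lies in the triangle with vertices \<open>0\<close>, \<open>v\<close>, \<open>e\<close>, hence in \<open>K\<close>, so stability puts it
into the stencil; its coordinate along \<open>f\<close> is smaller.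
\<close>

lemma descendant_forces:
  assumes "\<bar>det2 f e\<bar> = 1" "dot2 f e \<ge> 0" "real_vec e \<in> K"
    and "comb2 a f b e \<in> V" "a \<ge> 1" "b \<ge> 1"
  shows "e \<in> V"
  using assms(4-)
proof (induction "nat a" arbitrary: a b rule: less_induct)
  case less
  let ?v = "comb2 a f b e"
  have "coprime a b" using irreducible[OF less.prems(1)] by (rule coprime_coords)
  then obtain a1 b1 a2 b2 where *: "a1 \<ge> 0" "b1 \<ge> 0" "a2 \<ge> 0" "b2 \<ge> 0"
    "a = a1 + a2" "b = b1 + b2" "a1 * b2 - a2 * b1 = 1"
    and par: "parents ?v (comb2 a1 f b1 e) (comb2 a2 f b2 e) \<or> parents ?v (comb2 a2 f b2 e) (comb2 a1 f b1 e)"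
    using parents_in_cone[OF assms(1,2) less.prems(2,3)] by metis
  let ?q = "comb2 a2 f b2 e"
  have "a1 * b2 > 0" using * by (smt (verit) mult_nonneg_nonneg)
  then have a1: "a1 \<ge> 1" "b2 \<ge> 1" using *(1,4) by (auto simp: zero_less_mult_iff)
  have ab: "real_of_int a * b2 - a2 * b = 1"
    using * by (simp add: algebra_simps flip: of_int_mult of_int_diff of_int_add)
  have "real_vec ?q = (of_int a2 / of_int a) *\<^sub>R real_vec ?v + (1 / of_int a) *\<^sub>R real_vec e"
  proof -
    have "real_of_int b2 = of_int a2 / of_int a * of_int b + 1 / of_int a"
      using ab less.prems(2) by (simp add: field_simps)
    moreover have "real_of_int a2 = of_int a2 / of_int a * of_int a" using less.prems(2) by simp
    ultimately show ?thesis
      unfolding real_vec_comb2 by (metis (no_types, lifting) scaleR_add_left scaleR_add_right scaleR_scaleR add.assoc)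
  qed
  moreover have "of_int a2 / of_int a + 1 / of_int a \<le> (1::real)"
    using * a1 less.prems(2) by (simp add: field_simps)
  ultimately have "real_vec ?q \<in> K"
    using convex_triangle[OF convex zero in_K[OF less.prems(1)] assms(3), of "of_int a2 / of_int a" "1 / of_int a"] * less.prems(2)
    by simp
  then have q: "?q \<in> V" using stable[OF less.prems(1)] par by blast
  show ?case
  proof (cases "a2 = 0")
    case True
    then have "a1 * b2 = 1" using * by simp
    then have "b2 = 1" using a1 by (simp add: pos_zmult_eq_1_iff)
    then show ?thesis using q True by (simp add: comb2_def)
  next
    case False
    then show ?thesis using less.hyps[OF _ q] * a1 by auto
  qed
qed

text \<open>
Visibility enters the argument only in this form.
\<close>

lemma halfplane:
  assumes "\<And>v. v \<in> V \<Longrightarrow> s * det2 v g \<le> 0" "irreducible_vec e" "real_vec e \<in> K"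
  shows "s * det2 e g \<le> 0"
proof -
  define c :: "real \<times> real" where "c = (of_int (s * snd g), - of_int (s * fst g))"
  have c: "c \<bullet> real_vec v = of_int (s * det2 v g)" for v
    by (simp add: c_def real_vec_def det2_def algebra_simps)
  have "convex_cone hull (real_vec ` V) \<subseteq> {v. c \<bullet> v \<le> 0}"
    by (rule hull_minimal) (use assms(1) in \<open>auto simp: c convex_cone_halfspace_le simp del: of_int_mult\<close>)
  then have "c \<bullet> real_vec e \<le> 0" using visible[OF assms(2,3)] by blast
  then show ?thesis unfolding c by linarith
qed

text \<open>
If a unit vector \<open>e\<close> were missing, no vector of the stencil could have a positive component along \<open>e\<close>: one
in the open quadrants next to \<open>e\<close> is a descendant of \<open>e\<close>, and one on the axis is \<open>e\<close> itself.  Then \<open>e\<close> could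
not be visible.
\<close>

lemma unit_in_stencil:
  assumes e: "dot2 e e = 1" and K: "real_vec e \<in> K"
  shows "e \<in> V"
proof (rule ccontr)
  assume ne: "e \<notin> V"
  define f where "f = (snd e, - fst e)"
  have d: "det2 f e = 1" "dot2 f e = 0" using e by (auto simp: f_def det2_def dot2_def algebra_simps)
  have d': "\<bar>det2 (- f) e\<bar> = 1" "dot2 (-f) e \<ge> 0" using d by (auto simp: det2_def dot2_def algebra_simps)
  have irr: "irreducible_vec e" using irreducible_det2_1[of f e] d by simp
  have "-1 * det2 v f \<le> 0" if v: "v \<in> V" for v
  proof (rule ccontr)
    assume "\<not> -1 * det2 v f \<le> 0"
    then have b: "det2 f v \<ge> 1" using det2_swap[of f v] by linarith
    have vv: "v = comb2 (det2 v e) f (det2 f v) e"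
      using comb2_det2_coords[of f e 1 v] d by simp
    consider "det2 v e \<ge> 1" | "det2 v e = 0" | "- det2 v e \<ge> 1" by linarith
    then show False
    proof cases
      case 1
      then show False using descendant_forces[of f e "det2 v e" "det2 f v"] d K v b vv ne by simp
    next
      case 2
      have "irreducible_vec (comb2 0 f (det2 f v) e)" using irreducible[OF v] vv 2 by simp
      then have "det2 f v = 1" using coprime_coords b by fastforce
      then have "v = e" using vv 2 by (simp add: comb2_def)
      then show False using v ne by simp
    next
      case 3
      have "v = comb2 (- det2 v e) (- f) (det2 f v) e" using vv by (simp add: comb2_def)
      then show False using descendant_forces[OF d' K, of "- det2 v e" "det2 f v"] v b ne 3 by simp
    qed
  qed
  from halfplane[of "-1" f, OF this irr K] have "det2 e f \<ge> 0" by simp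
  then show False using d det2_swap[of e f] by simp
qed

text \<open>
Write a vector \<open>v\<close> of the stencil as \<open>a f + b g\<close> and suppose that \<open>f \<notin> K\<close>.  If \<open>a \<ge> 1\<close> and
\<open>b \<le> 0\<close>, then \<open>f\<close> would lie in the triangle with vertices \<open>0\<close>, \<open>v\<close>, \<open>e\<close>; if \<open>a \<ge> 1\<close> and \<open>b \<ge> 1\<close>,
then \<open>v\<close> is \<open>e\<close> or one of its descendants.  So \<open>a \<le> 0\<close> on the whole stencil, which contradicts the visibility of
\<open>e\<close>, where \<open>a = 1\<close>.
\<close>

lemma parent_in_K:
  assumes d: "\<bar>det2 f g\<bar> = 1" "dot2 f g \<ge> 0" and K: "real_vec (f + g) \<in> K" and ne: "f + g \<notin> V"
  shows "real_vec f \<in> K"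
proof (rule ccontr)
  assume nf: "real_vec f \<notin> K"
  define e where "e = f + g"
  define s where "s = det2 f g"
  have s: "s * s = 1" "det2 f g = s" using d by (auto simp: s_def abs_if split: if_splits)
  have fe: "\<bar>det2 f e\<bar> = 1" "\<bar>det2 g e\<bar> = 1" "dot2 f e \<ge> 0" "dot2 g e \<ge> 0" "det2 e g = s"
    using d dot2_self_nonneg[of f] dot2_self_nonneg[of g] det2_swap[of g f] s
    by (auto simp: e_def dot2_add dot2_commute) (auto simp: det2_def algebra_simps)
  have irr: "irreducible_vec e" using irreducible_det2_1 fe by blast
  have "s * det2 v g \<le> 0" if v: "v \<in> V" for v
  proof (rule ccontr)
    define a where "a = s * det2 v g"
    define b where "b = s * det2 f v"
    assume "\<not> s * det2 v g \<le> 0"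
    then have a: "a \<ge> 1" by (simp add: a_def)
    have vv: "v = comb2 a f b g"
      using comb2_det2_coords[OF s(2,1), of v] by (simp add: a_def b_def)
    show False
    proof (cases "b \<ge> 1")
      case False
      define d where "d = real_of_int (a - b)"
      have d1: "d \<ge> 1" using a False by (simp add: d_def)
      have "real_vec f = (1 / d) *\<^sub>R real_vec v + (- b / d) *\<^sub>R real_vec e"
      proof -
        have "(a - b) / d = 1" using d1 unfolding d_def by simp
        then have "1 / d * a + - b / d = 1" "1 / d * b + - b / d = 0" by (auto simp: diff_divide_distrib)
        moreover have "(1 / d) *\<^sub>R real_vec v + (- b / d) *\<^sub>R real_vec e =
           (1 / d * a + - b / d) *\<^sub>R real_vec f + (1 / d * b + - b / d) *\<^sub>R real_vec g"
          unfolding vv e_def real_vec_comb2 real_vec_add by (simp only: scaleR_add_left scaleR_add_right scaleR_scaleR add_ac)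
        ultimately show ?thesis by simp
      qed
      moreover have "1 / d + - b / d \<le> 1" using d1 a by (simp add: field_simps d_def)
      ultimately show False
        using convex_triangle[OF convex zero in_K[OF v] K[folded e_def], of "1 / d" "- b / d"] d1 False nf
        by (simp del: minus_divide_left add: divide_le_0_iff)
    next
      case True
      consider "a > b" | "a < b" | "a = b" by linarith
      then show False
      proof cases
        case 1
        have "v = comb2 (a - b) f b e" unfolding vv e_def by (simp add: comb2_def algebra_simps)
        then show False using descendant_forces[OF fe(1,3) K[folded e_def], of "a - b" b] 1 True v ne by (simp add: e_def)
      next
        case 2
        have "v = comb2 (b - a) g a e" unfolding vv e_def by (simp add: comb2_def algebra_simps)
        then show False using descendant_forces[OF fe(2,4) K[folded e_def], of "b - a" a] 2 a v ne by (simp add: e_def)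
      next
        case 3
        have "coprime a b" using irreducible[OF v] vv coprime_coords by blast
        then have "a = 1" "b = 1" using 3 a by auto
        then have "v = e" unfolding vv e_def by (simp add: comb2_def prod_eq_iff)
        then show False using v ne by (simp add: e_def)
      qed
    qed
  qed
  from halfplane[of s g, OF this irr K[folded e_def]] show False using fe s by simp
qed

text \<open>
Induction on the length: a missing vector is not a unit vector and has both parents in \<open>K\<close>, so it is
either a candidate or has a missing parent, from which it inherits superfluity.
\<close>

lemma necessary_subset:
  assumes \<phi>: "convex_on K \<phi>"
    and cand: "\<And>e f g. parents e f g \<Longrightarrow> f \<in> V \<Longrightarrow> g \<in> V \<Longrightarrow> real_vec e \<in> K \<Longrightarrow> e \<notin> V \<Longrightarrow>
      \<phi> (real_vec f) + \<phi> (real_vec g) \<le> \<phi> (real_vec e) + \<phi> 0"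
  shows "necessary K \<phi> \<subseteq> V"
proof -
  have "superfluous K \<phi> e" if "irreducible_vec e" "real_vec e \<in> K" "e \<notin> V" for e
    using that
  proof (induction "nat (dot2 e e)" arbitrary: e rule: less_induct)
    case less
    have "dot2 e e \<noteq> 1" using unit_in_stencil less.prems by blast
    then have "e \<notin> {(1,0),(-1,0),(0,1),(0,-1)}" by (auto simp: dot2_def)
    then obtain f g where fg: "parents e f g" using unit_or_parents less.prems by blast
    then have *: "det2 f g = 1" "dot2 f g \<ge> 0" "e = f + g" by (auto simp: parents_iff)
    have f: "real_vec f \<in> K" using parent_in_K[of f g] * less.prems by auto
    have g: "real_vec g \<in> K"
      using parent_in_K[of g f] * less.prems det2_swap[of g f] by (auto simp: dot2_commute add.commute)
    show ?case
    proof (cases "f \<in> V \<and> g \<in> V")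
      case True
      then show ?thesis using cand[OF fg] f g less.prems superfluousI[OF fg] by blast
    next
      case False
      then obtain k where k: "k = f \<or> k = g" "k \<notin> V" by blast
      then have "superfluous K \<phi> k"
        using less.hyps[of k] f g dot2_self_gt_parents[OF fg] irreducible_parents[OF fg]
          dot2_self_nonneg[of k] by auto
      then show ?thesis
        using superfluous_child[OF \<phi> zero less.prems(2) _ fg k(1)] f g k by auto
    qed
  qed
  then show ?thesis by (auto simp: necessary_def)
qed

end

section \<open>The minimal family of stencils\<close>

lemma rot_add: "rot \<theta> (u + v) = rot \<theta> u + rot \<theta> v"
  by (simp add: rot_def algebra_simps)

lemma rot_scaleR: "rot \<theta> (c *\<^sub>R v) = c *\<^sub>R rot \<theta> v"
  by (simp add: rot_def algebra_simps)

lemma rot_minus: "rot \<theta> (- v) = - rot \<theta> v"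
  by (simp add: rot_def)

lemma rot_diff: "rot \<theta> (u - v) = rot \<theta> u - rot \<theta> v"
  by (simp add: rot_def algebra_simps)

lemma rot_zero [simp]: "rot \<theta> 0 = 0"
  by (simp add: rot_def zero_prod_def)

lemma norm_rot [simp]: "norm (rot \<theta> v) = norm v"
proof -
  have "(cos \<theta> * a - sin \<theta> * b)\<^sup>2 + (sin \<theta> * a + cos \<theta> * b)\<^sup>2 = ((sin \<theta>)\<^sup>2 + (cos \<theta>)\<^sup>2) * (a\<^sup>2 + b\<^sup>2)" for a b
    unfolding power2_eq_square by (simp add: algebra_simps del: sin_cos_squared_add3)
  then show ?thesis by (simp add: rot_def norm_prod_def)
qed

definition lattice_view :: "real \<Rightarrow> real \<Rightarrow> real \<times> real \<Rightarrow> real \<times> real \<Rightarrow> real \<times> real" where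
  "lattice_view h \<theta> x v = x + h *\<^sub>R rot \<theta> v"

lemma shift_eq: "shift h \<theta> x e = lattice_view h \<theta> x (real_vec e)"
  by (simp add: shift_def lattice_view_def)

lemma lattice_view_zero [simp]: "lattice_view h \<theta> x 0 = x"
  by (simp add: lattice_view_def)

lemma lattice_view_affine:
  assumes "u + v = 1"
  shows "lattice_view h \<theta> x (u *\<^sub>R a + v *\<^sub>R b) = u *\<^sub>R lattice_view h \<theta> x a + v *\<^sub>R lattice_view h \<theta> x b"
proof -
  have "u *\<^sub>R x + v *\<^sub>R x = x" using assms by (simp flip: scaleR_add_left)
  moreover have "u *\<^sub>R lattice_view h \<theta> x a + v *\<^sub>R lattice_view h \<theta> x b
     = (u *\<^sub>R x + v *\<^sub>R x) + h *\<^sub>R rot \<theta> (u *\<^sub>R a + v *\<^sub>R b)"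
    by (simp add: lattice_view_def rot_add rot_scaleR algebra_simps)
  ultimately show ?thesis by (simp add: lattice_view_def)
qed

lemma convex_on_lattice_view:
  assumes "convex_on \<Omega> U"
  shows "convex_on (lattice_view h \<theta> x -` \<Omega>) (\<lambda>v. U (lattice_view h \<theta> x v))"
  using assms unfolding convex_on_def convex_def by (auto simp: lattice_view_affine)

text \<open>
From a grid point, membership in the grid and membership in \<open>\<Omega>\<close> are the same condition, so the discrete
set \<open>X\<close> may be replaced by a convex one.
\<close>

lemma shift_in_grid_points:
  assumes "x \<in> grid_points \<Omega> h \<theta> \<xi>"
  shows "shift h \<theta> x e \<in> grid_points \<Omega> h \<theta> \<xi> \<longleftrightarrow> real_vec e \<in> lattice_view h \<theta> x -` \<Omega>"
proof -
  obtain k where "x = h *\<^sub>R rot \<theta> (\<xi> + real_vec k)" using assms by (auto simp: grid_points_def)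
  then have "shift h \<theta> x e = h *\<^sub>R rot \<theta> (\<xi> + real_vec (k + e))"
    by (simp add: shift_def real_vec_add rot_add algebra_simps)
  then show ?thesis by (auto simp: grid_points_def shift_eq)
qed

definition needed :: "real \<Rightarrow> real \<Rightarrow> (real \<times> real) set \<Rightarrow> (real \<times> real \<Rightarrow> real) \<Rightarrow> real \<times> real \<Rightarrow> (int \<times> int) set" where
  "needed h \<theta> \<Omega> U x = necessary (lattice_view h \<theta> x -` \<Omega>) (\<lambda>v. U (lattice_view h \<theta> x v))"

text \<open>
The origin is the barycentre of \<open>e\<close>, \<open>- f\<close>, \<open>- g\<close>; this is the condition \<open>T_form \<ge> 0\<close>.
\<close>

lemma convex_on_three_points:
  assumes "convex_on K \<phi>" "0 \<in> K" "e \<in> K" "- f \<in> K" "- g \<in> K" "e = f + g"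
  shows "3 * \<phi> 0 \<le> \<phi> e + \<phi> (- f) + \<phi> (- g)"
proof -
  have cK: "convex K" using assms(1) by (rule convex_on_imp_convex)
  define m where "m = (1/2) *\<^sub>R (- f) + (1/2) *\<^sub>R (- g)"
  have m: "m \<in> K" unfolding m_def by (rule convexD[OF cK]) (use assms in auto)
  have "\<phi> m \<le> (1/2) * \<phi> (- f) + (1/2) * \<phi> (- g)"
    using convex_onD[OF assms(1), of "1/2" "- f" "- g"] assms by (simp add: m_def)
  moreover have "\<phi> ((1 - 2/3) *\<^sub>R e + (2/3) *\<^sub>R m) \<le> (1 - 2/3) * \<phi> e + (2/3) * \<phi> m"
    by (rule convex_onD[OF assms(1)]) (use assms m in auto)
  moreover have "(1 - 2/3) *\<^sub>R e + (2/3) *\<^sub>R m = 0"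
    unfolding m_def assms(6) by (simp add: algebra_simps flip: scaleR_add_left)
  ultimately show ?thesis by simp
qed

text \<open>
The necessary directions are verified to form a family of stencils whose cone contains \<open>U\<close>, and every
other such family contains them.  This also proves that a least family exists.
\<close>

lemma minimal_stencils_eq:
  fixes h \<theta> \<xi>
  assumes U: "convex_on \<Omega> U"
  defines "X \<equiv> grid_points \<Omega> h \<theta> \<xi>"
  shows "minimal_stencils h \<theta> X U = (\<lambda>x. if x \<in> X then needed h \<theta> \<Omega> U x else {})"
    (is "_ = ?V")
proof -
  let ?K = "\<lambda>x. lattice_view h \<theta> x -` \<Omega>" and ?\<phi> = "\<lambda>x v. U (lattice_view h \<theta> x v)"
  have conv: "convex_on (?K x) (?\<phi> x)" for x by (rule convex_on_lattice_view[OF U])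
  have X: "shift h \<theta> x e \<in> X \<longleftrightarrow> real_vec e \<in> ?K x" if "x \<in> X" for x e
    using shift_in_grid_points that unfolding X_def by blast
  have zero: "0 \<in> ?K x" if "x \<in> X" for x using that by (auto simp: X_def grid_points_def)
  have Vmax: "V_max h \<theta> X x = {e. irreducible_vec e \<and> real_vec e \<in> ?K x}" if "x \<in> X" for x
    using X[OF that] by (simp add: V_max_def)
  have V: "?V x = necessary (?K x) (?\<phi> x)" if "x \<in> X" for x using that by (simp add: needed_def)
  have fam: "stencil_family h \<theta> X ?V"
    unfolding stencil_family_def
  proof (intro conjI allI impI ballI)
    fix x assume x: "x \<in> X"
    show sub: "?V x \<subseteq> V_max h \<theta> X x" unfolding V[OF x] Vmax[OF x] by (auto simp: necessary_def)
    show "{f, g} \<inter> V_max h \<theta> X x \<subseteq> ?V x" if "e \<in> ?V x" "parents e f g" for e f g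
      using that x necessary_stable[OF conv zero[OF x] _ that(2)] unfolding V[OF x] Vmax[OF x] by blast
    show "convex_cone hull (real_vec ` ?V x) = convex_cone hull (real_vec ` V_max h \<theta> X x)"
    proof (rule subset_antisym)
      show "convex_cone hull (real_vec ` ?V x) \<subseteq> convex_cone hull (real_vec ` V_max h \<theta> X x)"
        by (rule hull_mono) (use sub in blast)
      show "convex_cone hull (real_vec ` V_max h \<theta> X x) \<subseteq> convex_cone hull (real_vec ` ?V x)"
        by (rule hull_minimal)
           (use necessary_visible in \<open>auto simp: V[OF x] Vmax[OF x] convex_cone_convex_cone_hull\<close>)
    qed
  qed simp
  have U_in: "U \<in> Conv_stencils h \<theta> X ?V"
    unfolding Conv_stencils_def
  proof (intro CollectI ballI conjI allI impI)
    fix x e assume x: "x \<in> X" and "S_support h \<theta> x e \<subseteq> X"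
    then have K: "real_vec e \<in> ?K x" "- real_vec e \<in> ?K x"
      using X[OF x] by (auto simp: S_support_def simp flip: real_vec_uminus)
    show "S_form h \<theta> x e U \<ge> 0"
      using convex_on_swap_chord[OF conv K, of "1/2"] by (simp add: S_form_def shift_eq real_vec_uminus)
  next
    fix x e f g assume x: "x \<in> X" and "parents e f g" "T_support h \<theta> x e f g \<subseteq> X"
    then have "real_vec e \<in> ?K x" "- real_vec f \<in> ?K x" "- real_vec g \<in> ?K x"
       "real_vec e = real_vec f + real_vec g"
      using X[OF x] by (auto simp: T_support_def parents_iff real_vec_add simp flip: real_vec_uminus)
    then show "T_form h \<theta> x e f g U \<ge> 0"
      using convex_on_three_points[OF conv zero[OF x]] by (fastforce simp: T_form_def shift_eq real_vec_uminus)
  next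
    fix x e f g assume x: "x \<in> X" and e: "e \<in> candidates h \<theta> X ?V x" and p: "parents e f g"
    have "superfluous (?K x) (?\<phi> x) e"
      using e x by (auto simp: candidates_def Vmax[OF x] V[OF x] needed_def necessary_def)
    then show "P_form h \<theta> x e f g U \<ge> 0"
      using parents_unique[OF p] by (fastforce simp: superfluous_def P_form_def shift_eq)
  qed
  have least: "?V \<le> W" if W: "stencil_family h \<theta> X W" "U \<in> Conv_stencils h \<theta> X W" for W
  proof (rule le_funI)
    fix x
    show "?V x \<le> W x"
    proof (cases "x \<in> X")
      case True
      have fam: "W x \<subseteq> V_max h \<theta> X x"
        "\<And>e f g. e \<in> W x \<Longrightarrow> parents e f g \<Longrightarrow> {f, g} \<inter> V_max h \<theta> X x \<subseteq> W x"
        "convex_cone hull (real_vec ` W x) = convex_cone hull (real_vec ` V_max h \<theta> X x)"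
        using W(1) True unfolding stencil_family_def by blast+
      interpret lattice_stencil "?K x" "W x"
      proof
        show "convex (?K x)" by (rule convex_on_imp_convex[OF conv])
        show "0 \<in> ?K x" by (rule zero[OF True])
        show "irreducible_vec v" "real_vec v \<in> ?K x" if "v \<in> W x" for v
          using that fam(1) Vmax[OF True] by auto
        show "k \<in> W x" if "v \<in> W x" "parents v f g" "k = f \<or> k = g" "real_vec k \<in> ?K x" for v f g k
        proof -
          have "k \<in> V_max h \<theta> X x"
            using that(3,4) irreducible_parents[OF that(2)] unfolding Vmax[OF True] by blast
          then show ?thesis using fam(2)[OF that(1,2)] that(3) by blast
        qed
        show "real_vec e \<in> convex_cone hull (real_vec ` W x)"
          if "irreducible_vec e" "real_vec e \<in> ?K x" for e
          unfolding fam(3) using that by (intro hull_inc imageI) (simp add: Vmax[OF True])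
      qed
      have "necessary (?K x) (?\<phi> x) \<subseteq> W x"
      proof (rule necessary_subset[OF conv])
        fix e f g assume p: "parents e f g" and "f \<in> W x" "g \<in> W x" "real_vec e \<in> ?K x" "e \<notin> W x"
        then have "e \<in> candidates h \<theta> X W x"
          using irreducible_parents(1)[OF p] unfolding candidates_def Vmax[OF True] by blast
        then have "P_form h \<theta> x e f g U \<ge> 0"
          using W(2) True p unfolding Conv_stencils_def by blast
        then show "?\<phi> x (real_vec f) + ?\<phi> x (real_vec g) \<le> ?\<phi> x (real_vec e) + ?\<phi> x 0"
          by (simp add: P_form_def shift_eq)
      qed
      then show ?thesis using V[OF True] by simp
    qed simp
  qed
  show ?thesis
    unfolding minimal_stencils_def by (rule Least_equality) (use fam U_in least in auto)
qed

section \<open>Angles at which a diagonal is flipped\<close>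

text \<open>
The pairs of an angle and a midpoint for which the diagonal with half-length vector \<open>a\<close> of a
parallelogram with half-diagonals \<open>a\<close>, \<open>b\<close> lies strictly below the other one, where an undefined
value counts as \<open>\<infinity>\<close>.  Points on the frontier of \<open>\<Omega>\<close>, where \<open>U\<close> may be discontinuous, are
excluded to make this an open set; \<open>edge_set\<close> collects them.
\<close>

definition flip_set :: "(real \<times> real) set \<Rightarrow> (real \<times> real \<Rightarrow> real) \<Rightarrow> real \<times> real \<Rightarrow> real \<times> real
    \<Rightarrow> (real \<times> (real \<times> real)) set" where
  "flip_set \<Omega> U a b = {(\<theta>, m). m + rot \<theta> a \<in> interior \<Omega> \<and> m - rot \<theta> a \<in> interior \<Omega> \<and>
     (m + rot \<theta> b \<notin> \<Omega> \<or> m - rot \<theta> b \<notin> \<Omega> \<or>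
      (m + rot \<theta> b \<in> interior \<Omega> \<and> m - rot \<theta> b \<in> interior \<Omega> \<and>
       U (m + rot \<theta> a) + U (m - rot \<theta> a) < U (m + rot \<theta> b) + U (m - rot \<theta> b)))}"

definition edge_set :: "(real \<times> real) set \<Rightarrow> real \<times> real \<Rightarrow> real \<times> real \<Rightarrow> (real \<times> (real \<times> real)) set" where
  "edge_set \<Omega> a b = {(\<theta>, m). \<exists>v\<in>{a, - a, b, - b}. m + rot \<theta> v \<in> frontier \<Omega>}"

lemma abs_le_2_abs_sin:
  assumes "\<bar>x\<bar> \<le> pi / 2" shows "\<bar>x\<bar> \<le> 2 * \<bar>sin x\<bar>"
proof -
  have "x \<le> 2 * sin x" if "0 \<le> x" "x \<le> pi / 2" for x :: real
  proof (cases "x \<le> pi / 3")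
    case True
    have "2 * sin 0 - 0 \<le> 2 * sin x - x"
    proof (rule DERIV_nonneg_imp_nondecreasing[OF that(1)])
      fix y assume y: "0 \<le> y" "y \<le> x"
      have "cos (pi / 3) \<le> cos y" using y True by (intro cos_monotone_0_pi_le) auto
      then show "\<exists>z. ((\<lambda>x. 2 * sin x - x) has_real_derivative z) (at y) \<and> 0 \<le> z"
        by (intro exI[of _ "2 * cos y - 1"]) (auto intro!: derivative_eq_intros simp: cos_60)
    qed
    then show ?thesis by simp
  next
    case False
    have "sin (pi / 3) \<le> sin x" using False that by (intro sin_monotone_2pi_le) auto
    moreover have "sqrt 3 \<ge> 1.7" by (rule real_le_rsqrt) (simp add: power2_eq_square)
    moreover have "pi / 2 \<le> 1.6" using pi_approx by simp
    ultimately show ?thesis using that by (simp add: sin_60)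
  qed
  from this[of "\<bar>x\<bar>"] assms show ?thesis by (auto simp: abs_if split: if_splits)
qed

lemma rotated_combination:
  fixes a b :: "real \<times> real"
  assumes a: "a \<bullet> a > 0" and sin: "sin (\<theta>1 - \<theta>2) \<noteq> 0"
  defines "s \<equiv> (fst a * snd b - snd a * fst b) / (a \<bullet> a * sin (\<theta>1 - \<theta>2))"
  shows "rot \<theta>2 b = s *\<^sub>R rot \<theta>1 a + (a \<bullet> b / (a \<bullet> a) - s * cos (\<theta>1 - \<theta>2)) *\<^sub>R rot \<theta>2 a"
proof -
  define \<psi> where "\<psi> = \<theta>1 - \<theta>2"
  have \<theta>1: "\<theta>1 = \<theta>2 + \<psi>" by (simp add: \<psi>_def)
  define r where "r = a \<bullet> a"
  have r: "r > 0" "r = fst a * fst a + snd a * snd a" using a by (auto simp: r_def inner_prod_def)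
  have "b = s *\<^sub>R rot \<psi> a + (a \<bullet> b / r - s * cos \<psi>) *\<^sub>R a"
  proof -
    have "s * sin \<psi> = (fst a * snd b - snd a * fst b) / r"
      using sin r by (simp add: s_def r_def[symmetric] \<psi>_def[symmetric])
    then have s1: "s * (x * sin \<psi>) = (fst a * snd b - snd a * fst b) / r * x" for x
      by (metis mult.assoc mult.commute)
    show ?thesis
      using r(1) by (auto simp: prod_eq_iff rot_def algebra_simps s1 inner_prod_def)
        (simp_all add: field_simps, simp_all add: r(2) algebra_simps)
  qed
  then have "rot \<theta>2 b = s *\<^sub>R rot \<theta>2 (rot \<psi> a) + (a \<bullet> b / r - s * cos \<psi>) *\<^sub>R rot \<theta>2 a"
    by (metis rot_add rot_scaleR)
  moreover have "rot \<theta>2 (rot \<psi> a) = rot \<theta>1 a"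
    unfolding \<theta>1 by (simp add: rot_def sin_add cos_add algebra_simps)
  ultimately show ?thesis by (simp add: r_def \<psi>_def)
qed

text \<open>
Four points with position vectors \<open>\<plusminus>a\<close>, rotated by both angles, span a rectangle inside the convex sublevel set
\<open>C\<close>.  If the angles are far apart, the coordinates of the rotated \<open>b\<close> in terms of these vectors have
absolute sum at most 1, so \<open>b\<close> falls into the rectangle and cannot be higher than \<open>a\<close>.
\<close>

lemma flip_angles_close_ordered:
  assumes U: "convex_on \<Omega> U"
    and flip: "(\<theta>1, m) \<in> flip_set \<Omega> U a b" "(\<theta>2, m) \<in> flip_set \<Omega> U a b"
    and \<theta>: "\<bar>\<theta>1 - \<theta>2\<bar> \<le> pi / 2" and ab: "\<bar>a \<bullet> b\<bar> < a \<bullet> a"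
    and le: "U (m + rot \<theta>1 a) + U (m - rot \<theta>1 a) \<le> U (m + rot \<theta>2 a) + U (m - rot \<theta>2 a)"
  shows "\<bar>\<theta>1 - \<theta>2\<bar> \<le> 4 * \<bar>fst a * snd b - snd a * fst b\<bar> / (a \<bullet> a - \<bar>a \<bullet> b\<bar>)"
proof -
  define d where "d = fst a * snd b - snd a * fst b"
  define W where "W = (\<lambda>v. U (m + v) + U (m - v))"
  \<comment> \<open>The sublevel set at the larger of the two values on the rotated copies of \<open>a\<close>.\<close>
  define C where "C = {v. m + v \<in> interior \<Omega> \<and> m - v \<in> interior \<Omega> \<and> W v \<le> W (rot \<theta>2 a)}"
  define \<psi> where "\<psi> = \<theta>1 - \<theta>2"
  have cI: "convex (interior \<Omega>)" using U convex_on_imp_convex convex_interior by blast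
  have "convex C"
  proof (rule convexI)
    fix x y u v assume xy: "x \<in> C" "y \<in> C" and uv: "0 \<le> u" "0 \<le> v" "u + v = (1::real)"
    have *: "m + (u *\<^sub>R x + v *\<^sub>R y) = u *\<^sub>R (m + x) + v *\<^sub>R (m + y)"
      "m - (u *\<^sub>R x + v *\<^sub>R y) = u *\<^sub>R (m - x) + v *\<^sub>R (m - y)"
      using uv(3) by (auto simp: algebra_simps simp flip: scaleR_add_left) 
    have mem: "m + (u *\<^sub>R x + v *\<^sub>R y) \<in> interior \<Omega>" "m - (u *\<^sub>R x + v *\<^sub>R y) \<in> interior \<Omega>"
      unfolding * using xy uv by (auto intro!: convexD[OF cI] simp: C_def)
    have U': "U (u *\<^sub>R p + v *\<^sub>R q) \<le> u * U p + v * U q" if "p \<in> interior \<Omega>" "q \<in> interior \<Omega>" for p q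
      using U uv that interior_subset[of \<Omega>] unfolding convex_on_def by blast
    have "W (u *\<^sub>R x + v *\<^sub>R y) \<le> u * W x + v * W y"
      using U'[of "m + x" "m + y"] U'[of "m - x" "m - y"] xy unfolding W_def * C_def
      by (simp add: algebra_simps)
    also have "\<dots> \<le> u * W (rot \<theta>2 a) + v * W (rot \<theta>2 a)"
      using xy uv by (intro add_mono mult_left_mono) (auto simp: C_def)
    also have "\<dots> = W (rot \<theta>2 a)" using uv by (simp flip: distrib_right)
    finally show "u *\<^sub>R x + v *\<^sub>R y \<in> C" using mem by (simp add: C_def)
  qed
  moreover have sym: "- v \<in> C" if "v \<in> C" for v using that by (auto simp: C_def W_def add.commute)
  have p: "rot \<theta>1 a \<in> C" "rot \<theta>2 a \<in> C"
    using le flip by (auto simp: C_def W_def flip_set_def)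
  have "(1/2) *\<^sub>R rot \<theta>1 a + (1/2) *\<^sub>R (- rot \<theta>1 a) \<in> C"
    by (rule convexD[OF \<open>convex C\<close>]) (use p sym in auto)
  then have "0 \<in> C" by simp
  have inC: "s *\<^sub>R rot \<theta>1 a + t *\<^sub>R rot \<theta>2 a \<in> C" if "\<bar>s\<bar> + \<bar>t\<bar> \<le> 1" for s t
  proof -
    have "\<bar>s\<bar> *\<^sub>R (if s \<ge> 0 then rot \<theta>1 a else - rot \<theta>1 a) + \<bar>t\<bar> *\<^sub>R (if t \<ge> 0 then rot \<theta>2 a else - rot \<theta>2 a) \<in> C"
      by (rule convex_triangle[OF \<open>convex C\<close> \<open>0 \<in> C\<close>]) (use p sym that in auto)
    then show ?thesis by (auto simp: abs_if split: if_splits)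
  qed
  have notC: "rot \<theta>2 b \<notin> C"
    using flip(2) interior_subset[of \<Omega>] by (auto simp: C_def W_def flip_set_def)
  show ?thesis
  proof (rule ccontr)
    assume "\<not> ?thesis"
    then have less: "4 * \<bar>d\<bar> < \<bar>\<psi>\<bar> * (a \<bullet> a - \<bar>a \<bullet> b\<bar>)"
      using ab by (simp add: d_def \<psi>_def pos_divide_less_eq not_le)
    have "\<bar>\<psi>\<bar> * (a \<bullet> a - \<bar>a \<bullet> b\<bar>) \<le> 2 * \<bar>sin \<psi>\<bar> * (a \<bullet> a - \<bar>a \<bullet> b\<bar>)"
      using abs_le_2_abs_sin[of \<psi>] \<theta> ab by (intro mult_right_mono) (auto simp: \<psi>_def)
    with less have sin: "2 * \<bar>d\<bar> < \<bar>sin \<psi>\<bar> * (a \<bullet> a - \<bar>a \<bullet> b\<bar>)" by linarith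
    then have "sin \<psi> \<noteq> 0" by auto
    define r where "r = a \<bullet> a"
    have r: "r > 0" using ab abs_ge_zero[of "a \<bullet> b"] unfolding r_def by linarith
    define s where "s = d / (r * sin \<psi>)"
    have s: "\<bar>s\<bar> * (r * \<bar>sin \<psi>\<bar>) = \<bar>d\<bar>" using r \<open>sin \<psi> \<noteq> 0\<close> by (simp add: s_def abs_mult)
    have "2 * \<bar>s\<bar> + \<bar>a \<bullet> b\<bar> / r \<le> 1"
    proof -
      have "2 * (\<bar>s\<bar> * (r * \<bar>sin \<psi>\<bar>)) \<le> \<bar>sin \<psi>\<bar> * (r - \<bar>a \<bullet> b\<bar>)"
        unfolding s using sin by (simp add: r_def)
      then have "\<bar>sin \<psi>\<bar> * (2 * \<bar>s\<bar> * r) \<le> \<bar>sin \<psi>\<bar> * (r - \<bar>a \<bullet> b\<bar>)" by (simp add: algebra_simps)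
      then have "2 * \<bar>s\<bar> * r \<le> r - \<bar>a \<bullet> b\<bar>" using \<open>sin \<psi> \<noteq> 0\<close> by simp
      then show ?thesis using r by (simp add: field_simps)
    qed
    moreover have "\<bar>a \<bullet> b / r - s * cos \<psi>\<bar> \<le> \<bar>a \<bullet> b\<bar> / r + \<bar>s\<bar>"
    proof -
      have "\<bar>s * cos \<psi>\<bar> \<le> \<bar>s\<bar>" by (simp add: abs_mult mult_left_le)
      then show ?thesis using r abs_triangle_ineq4[of "a \<bullet> b / r" "s * cos \<psi>"] by simp
    qed
    ultimately have "s *\<^sub>R rot \<theta>1 a + (a \<bullet> b / r - s * cos \<psi>) *\<^sub>R rot \<theta>2 a \<in> C"
      by (intro inC) linarith
    moreover have "rot \<theta>2 b = s *\<^sub>R rot \<theta>1 a + (a \<bullet> b / r - s * cos \<psi>) *\<^sub>R rot \<theta>2 a"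
      unfolding s_def r_def d_def \<psi>_def
      by (rule rotated_combination) (use r \<open>sin \<psi> \<noteq> 0\<close> in \<open>simp_all only: r_def \<psi>_def not_False_eq_True\<close>)
    ultimately show False using notC by simp
  qed
qed

lemma flip_angles_close:
  assumes U: "convex_on \<Omega> U"
    and flip: "(\<theta>1, m) \<in> flip_set \<Omega> U a b" "(\<theta>2, m) \<in> flip_set \<Omega> U a b"
    and \<theta>: "\<bar>\<theta>1 - \<theta>2\<bar> \<le> pi / 2" and ab: "\<bar>a \<bullet> b\<bar> < a \<bullet> a"
  shows "\<bar>\<theta>1 - \<theta>2\<bar> \<le> 4 * \<bar>fst a * snd b - snd a * fst b\<bar> / (a \<bullet> a - \<bar>a \<bullet> b\<bar>)"
  using flip_angles_close_ordered[OF U flip \<theta> ab] flip_angles_close_ordered[OF U flip(2,1) _ ab] \<theta>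
  by (cases "U (m + rot \<theta>1 a) + U (m - rot \<theta>1 a) \<le> U (m + rot \<theta>2 a) + U (m - rot \<theta>2 a)")
     (auto simp: abs_minus_commute)

lemma nn_integral_flip_angles_le:
  assumes U: "convex_on \<Omega> U" and ab: "\<bar>a \<bullet> b\<bar> < a \<bullet> a"
  defines "\<delta> \<equiv> 4 * \<bar>fst a * snd b - snd a * fst b\<bar> / (a \<bullet> a - \<bar>a \<bullet> b\<bar>)"
  shows "(\<integral>\<^sup>+\<theta>\<in>{0..pi/2}. indicator (flip_set \<Omega> U a b) (\<theta>, m) \<partial>lborel) \<le> ennreal (2 * \<delta>)"
proof (cases "\<exists>t\<in>{0..pi/2}. (t, m) \<in> flip_set \<Omega> U a b")
  case True
  then obtain t where t: "t \<in> {0..pi/2}" "(t, m) \<in> flip_set \<Omega> U a b" by blast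
  have "\<bar>\<theta> - t\<bar> \<le> \<delta>" if "\<theta> \<in> {0..pi/2}" "(\<theta>, m) \<in> flip_set \<Omega> U a b" for \<theta>
    unfolding \<delta>_def by (rule flip_angles_close[OF U that(2) t(2) _ ab]) (use that t in \<open>auto simp: abs_if\<close>)
  then have "(\<integral>\<^sup>+\<theta>\<in>{0..pi/2}. indicator (flip_set \<Omega> U a b) (\<theta>, m) \<partial>lborel)
      \<le> (\<integral>\<^sup>+\<theta>. indicator {t - \<delta>..t + \<delta>} \<theta> \<partial>lborel)"
    by (intro nn_integral_mono) (force simp: indicator_def abs_le_iff)
  also have "\<dots> = ennreal (2 * \<delta>)"
    using ab by (simp add: \<delta>_def)
  finally show ?thesis .
next
  case False
  then have "(\<integral>\<^sup>+\<theta>\<in>{0..pi/2}. indicator (flip_set \<Omega> U a b) (\<theta>, m) \<partial>lborel) = (\<integral>\<^sup>+\<theta>. 0 \<partial>(lborel :: real measure))"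
    by (intro nn_integral_cong) (auto simp: indicator_def)
  then show ?thesis by simp
qed

text \<open>
For the diagonals of a lattice parallelogram the bound on the distance of two angles is 4 divided by
\<open>min (\<parallel>f\<parallel>\<^sup>2) (\<parallel>g\<parallel>\<^sup>2) + \<langle>f, g\<rangle>\<close>.  The denominator is at least \<open>\<parallel>f\<parallel> \<parallel>g\<parallel>\<close>, because
\<open>\<langle>f, g\<rangle>\<^sup>2 = \<parallel>f\<parallel>\<^sup>2 \<parallel>g\<parallel>\<^sup>2 - 1\<close> gives \<open>\<langle>f, g\<rangle> \<ge> \<parallel>f\<parallel> \<parallel>g\<parallel> - 1\<close>.
\<close>

lemma nn_integral_flip_angles_basis_le:
  assumes U: "convex_on \<Omega> U" and fg: "det2 f g = 1" "dot2 f g \<ge> 0" and h: "h > 0"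
  shows "(\<integral>\<^sup>+\<theta>\<in>{0..pi/2}. indicator (flip_set \<Omega> U ((h/2) *\<^sub>R real_vec (f + g)) ((h/2) *\<^sub>R (real_vec f - real_vec g))) (\<theta>, m) \<partial>lborel)
     \<le> ennreal (8 / (norm (real_vec f) * norm (real_vec g)))"
proof -
  define a b where "a = (h/2) *\<^sub>R real_vec (f + g)" and "b = (h/2) *\<^sub>R (real_vec f - real_vec g)"
  define F G where "F = norm (real_vec f)" and "G = norm (real_vec g)"
  have "dot2 f f \<ge> 1" "dot2 g g \<ge> 1" using fg by (auto intro!: dot2_self_pos simp: det2_def)
  then have FG: "F \<ge> 1" "G \<ge> 1" by (auto simp: F_def G_def norm_real_vec)
  have FG2: "F\<^sup>2 = dot2 f f" "G\<^sup>2 = dot2 g g" 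
    by (auto simp: F_def G_def norm_real_vec dot2_self_nonneg)
  define D where "D = real_of_int (dot2 f g)"
  have D: "D \<ge> 0" using fg by (simp add: D_def)
  have "1 + D\<^sup>2 = F\<^sup>2 * G\<^sup>2"
    using det2_dot2_sq[of f g] fg(1) unfolding FG2 D_def by (metis of_int_1 of_int_add of_int_mult of_int_power power_one)
  moreover have FG1: "F * G \<ge> 1" using FG mult_mono[of 1 F 1 G] by simp
  ultimately have "(F * G - 1)\<^sup>2 \<le> D\<^sup>2"
    by (simp add: power2_eq_square algebra_simps)
  then have D1: "F * G - 1 \<le> D" using D by (rule power2_le_imp_le)
  have aa: "a \<bullet> a = h\<^sup>2 / 4 * (F\<^sup>2 + G\<^sup>2 + 2 * D)"
    unfolding a_def FG2 D_def by (simp add: inner_real_vec dot2_add dot2_commute power2_eq_square field_simps)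
  have ab: "a \<bullet> b = h\<^sup>2 / 4 * (F\<^sup>2 - G\<^sup>2)"
    unfolding a_def b_def FG2 by (simp add: inner_diff_right inner_real_vec dot2_add dot2_commute power2_eq_square field_simps)
  have det: "fst a * snd b - snd a * fst b = - (h\<^sup>2 / 2)"
  proof -
    have "fst a * snd b - snd a * fst b = - (h\<^sup>2 / 2) * of_int (det2 f g)"
      by (simp add: a_def b_def real_vec_def det2_def power2_eq_square field_simps)
    then show ?thesis using fg by simp
  qed
  have "F\<^sup>2 \<ge> 1" "G\<^sup>2 \<ge> 1" using FG by auto
  then have "F\<^sup>2 + G\<^sup>2 + 2 * D - \<bar>F\<^sup>2 - G\<^sup>2\<bar> \<ge> 2 * (F * G)"
    using D1 by (simp add: abs_if)
  then have "h\<^sup>2 / 4 * (F\<^sup>2 + G\<^sup>2 + 2 * D - \<bar>F\<^sup>2 - G\<^sup>2\<bar>) \<ge> h\<^sup>2 / 4 * (2 * (F * G))"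
    by (intro mult_left_mono) auto
  then have gap: "a \<bullet> a - \<bar>a \<bullet> b\<bar> \<ge> h\<^sup>2 / 2 * (F * G)"
    unfolding aa ab abs_mult by (simp add: algebra_simps)
  have pos: "h\<^sup>2 / 2 * (F * G) > 0" using h FG1 by simp
  then have "\<bar>a \<bullet> b\<bar> < a \<bullet> a" using gap by linarith
  from nn_integral_flip_angles_le[OF U this, of m]
  have "(\<integral>\<^sup>+\<theta>\<in>{0..pi/2}. indicator (flip_set \<Omega> U a b) (\<theta>, m) \<partial>lborel)
     \<le> ennreal (2 * (4 * (h\<^sup>2 / 2) / (a \<bullet> a - \<bar>a \<bullet> b\<bar>)))" unfolding det by simp
  also have "\<dots> \<le> ennreal (2 * (4 * (h\<^sup>2 / 2) / (h\<^sup>2 / 2 * (F * G))))"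
    using gap pos by (intro ennreal_leI mult_left_mono divide_left_mono) auto
  also have "2 * (4 * (h\<^sup>2 / 2) / (h\<^sup>2 / 2 * (F * G))) = 8 / (F * G)"
    using h by simp
  finally show ?thesis by (simp only: a_def b_def F_def G_def)
qed

section \<open>A sum over the bases of the lattice\<close>

lemma finite_dot2_le: "finite {f. dot2 f f \<le> n}"
proof (rule finite_subset)
  show "{f. dot2 f f \<le> n} \<subseteq> {-n..n} \<times> {-n..n}"
  proof clarify
    fix a b assume "dot2 (a, b) (a, b) \<le> n"
    then have *: "a * a + b * b \<le> n" by (simp add: dot2_def)
    have "\<bar>c\<bar> \<le> c * c" for c :: int
      using mult_right_mono[of 1 "\<bar>c\<bar>" "\<bar>c\<bar>"] by (cases "c = 0") (auto simp: abs_mult_self_eq)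
    from this[of a] this[of b] show "a \<in> {-n..n} \<and> b \<in> {-n..n}"
      using * by auto
  qed
qed auto

lemma harm_le_one_plus_ln: "n > 0 \<Longrightarrow> harm n \<le> 1 + ln (real n)"
proof (induction n rule: nat_induct_non_zero)
  case 1
  then show ?case by (simp add: harm_def)
next
  case (Suc n)
  have "ln (real n / real (Suc n)) \<le> real n / real (Suc n) - 1"
    using Suc by (intro ln_le_minus_one) auto
  moreover have "real n / real (Suc n) - 1 = - inverse (real (Suc n))"
    by (simp add: field_simps)
  ultimately have "inverse (real (Suc n)) \<le> ln (real (Suc n)) - ln (real n)"
    using Suc by (simp add: ln_div)
  then show ?case using Suc by (simp add: harm_Suc)
qed

text \<open>
Split the lattice by which coordinate is larger in absolute value; there are \<open>2 |i| + 1 \<le> 3 |i|\<close> vectors with larger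
coordinate \<open>i\<close>, and each contributes at most \<open>1 / i\<^sup>2\<close>.
\<close>

lemma sum_inverse_dot2_le_harm:
  fixes n :: nat
  shows "(\<Sum>f | f \<noteq> 0 \<and> dot2 f f \<le> int n. 1 / real_of_int (dot2 f f)) \<le> 12 * harm n"
proof -
  define A where "A = (SIGMA i:{i. \<bar>i\<bar> \<in> {1..int n}}. {-\<bar>i\<bar>..\<bar>i\<bar>})"
  have finI: "finite {i. \<bar>i\<bar> \<in> {1..int n}}"
    by (rule finite_subset[of _ "{- int n..int n}"]) auto
  have finA: "finite A" unfolding A_def using finI by auto
  have sub: "{f. f \<noteq> 0 \<and> dot2 f f \<le> int n} \<subseteq> A \<union> prod.swap ` A"
  proof clarify
    fix a b :: int assume "(a, b) \<notin> prod.swap ` A" "dot2 (a, b) (a, b) \<le> int n" "(a,b) \<noteq> 0"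
    then have *: "(b, a) \<notin> A" "a * a + b * b \<le> int n" "a \<noteq> 0 \<or> b \<noteq> 0"
      by (force simp: dot2_def zero_prod_def)+
    have "\<bar>c\<bar> \<le> c * c" for c :: int
      using mult_right_mono[of 1 "\<bar>c\<bar>" "\<bar>c\<bar>"] by (cases "c = 0") (auto simp: abs_mult_self_eq)
    from this[of a] this[of b] have "\<bar>a\<bar> \<le> int n" "\<bar>b\<bar> \<le> int n"
      using * zero_le_square[of a] zero_le_square[of b] by linarith+
    then show "(a, b) \<in> A" using * unfolding A_def by auto
  qed
  have "(\<Sum>i | \<bar>i\<bar> \<in> {1..int n}. 1 / \<bar>real_of_int i\<bar>) = (\<Sum>i\<in>{1..n}. 1 / real i) + (\<Sum>i\<in>{1..n}. 1 / real i)"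
  proof -
    have "{i. \<bar>i\<bar> \<in> {1..int n}} = int ` {1..n} \<union> (\<lambda>i. - int i) ` {1..n}"
    proof (intro subset_antisym subsetI)
      fix i assume "i \<in> {i. \<bar>i\<bar> \<in> {1..int n}}"
      then show "i \<in> int ` {1..n} \<union> (\<lambda>i. - int i) ` {1..n}"
        by (cases "i \<ge> 0") (auto simp: image_iff intro!: bexI[of _ "nat \<bar>i\<bar>"])
    qed auto
    then have "(\<Sum>i | \<bar>i\<bar> \<in> {1..int n}. 1 / \<bar>real_of_int i\<bar>)
       = (\<Sum>i\<in>int ` {1..n}. 1 / \<bar>real_of_int i\<bar>) + (\<Sum>i\<in>(\<lambda>i. - int i) ` {1..n}. 1 / \<bar>real_of_int i\<bar>)"
      by (simp only:) (rule sum.union_disjoint, auto)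
    also have "\<dots> = (\<Sum>i\<in>{1..n}. 1 / real i) + (\<Sum>i\<in>{1..n}. 1 / real i)"
      by (subst (1 2) sum.reindex) (auto simp: inj_on_def)
    finally show ?thesis .
  qed
  also have "\<dots> = 2 * harm n" by (simp add: harm_def divide_inverse)
  finally have H: "(\<Sum>i | \<bar>i\<bar> \<in> {1..int n}. 1 / \<bar>real_of_int i\<bar>) = 2 * harm n" .
  have "(\<Sum>f\<in>A. 1 / real_of_int (dot2 f f)) = (\<Sum>i | \<bar>i\<bar> \<in> {1..int n}. \<Sum>j\<in>{-\<bar>i\<bar>..\<bar>i\<bar>}. 1 / real_of_int (dot2 (i, j) (i, j)))"
    unfolding A_def by (subst sum.Sigma) (use finI in auto)
  also have "\<dots> \<le> (\<Sum>i | \<bar>i\<bar> \<in> {1..int n}. 3 * (1 / \<bar>real_of_int i\<bar>))"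
  proof (rule sum_mono)
    fix i assume i: "i \<in> {i. \<bar>i\<bar> \<in> {1..int n}}"
    have "(\<Sum>j\<in>{-\<bar>i\<bar>..\<bar>i\<bar>}. 1 / real_of_int (dot2 (i, j) (i, j))) \<le> (\<Sum>j\<in>{-\<bar>i\<bar>..\<bar>i\<bar>}. 1 / (real_of_int i)\<^sup>2)"
      using i by (intro sum_mono frac_le) (auto simp: dot2_def power2_eq_square zero_less_mult_iff)
    also have "\<dots> = (2 * \<bar>real_of_int i\<bar> + 1) / \<bar>real_of_int i\<bar>\<^sup>2"
      by simp
    also have "\<dots> \<le> (3 * \<bar>real_of_int i\<bar>) / \<bar>real_of_int i\<bar>\<^sup>2"
      using i by (intro divide_right_mono) auto
    also have "\<dots> = 3 * (1 / \<bar>real_of_int i\<bar>)"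
      using i by (auto simp add: power2_eq_square simp del: abs_mult_self_eq)
    finally show "(\<Sum>j\<in>{-\<bar>i\<bar>..\<bar>i\<bar>}. 1 / real_of_int (dot2 (i, j) (i, j))) \<le> 3 * (1 / \<bar>real_of_int i\<bar>)" .
  qed
  also have "\<dots> = 6 * harm n" unfolding sum_distrib_left[symmetric] H by simp
  finally have 1: "(\<Sum>f\<in>A. 1 / real_of_int (dot2 f f)) \<le> 6 * harm n" .
  have 2: "(\<Sum>f\<in>prod.swap ` A. 1 / real_of_int (dot2 f f)) = (\<Sum>f\<in>A. 1 / real_of_int (dot2 f f))"
    by (subst sum.reindex) (auto simp: dot2_def add.commute inj_on_def case_prod_unfold)
  have "(\<Sum>f | f \<noteq> 0 \<and> dot2 f f \<le> int n. 1 / real_of_int (dot2 f f)) \<le> (\<Sum>f\<in>A \<union> prod.swap ` A. 1 / real_of_int (dot2 f f))"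
    using finA sub dot2_self_nonneg by (intro sum_mono2) auto
  also have "\<dots> \<le> (\<Sum>f\<in>A. 1 / real_of_int (dot2 f f)) + (\<Sum>f\<in>prod.swap ` A. 1 / real_of_int (dot2 f f))"
    using finA dot2_self_nonneg by (subst sum.union_inter[symmetric]) (auto intro!: sum_nonneg)
  finally show ?thesis using 1 2 by simp
qed

definition bases_upto :: "nat \<Rightarrow> ((int \<times> int) \<times> (int \<times> int)) set" where
  "bases_upto n = {(f, g). det2 f g = 1 \<and> dot2 f g \<ge> 0 \<and> dot2 f f \<le> int n \<and> dot2 g g \<le> int n}"

lemma finite_bases_upto: "finite (bases_upto n)"
  by (rule finite_subset[of _ "{f. dot2 f f \<le> int n} \<times> {f. dot2 f f \<le> int n}"])
     (auto simp: bases_upto_def finite_dot2_le)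

text \<open>
Suppose first that \<open>f\<close> is the shorter vector.  The bases with a given \<open>f\<close> differ by multiples of \<open>f\<close> added to \<open>g\<close>,
so they are numbered by the quotient \<open>k\<close> of \<open>\<langle>f, g\<rangle>\<close> by \<open>\<parallel>f\<parallel>\<^sup>2\<close>, and
\<open>\<parallel>f\<parallel> \<parallel>g\<parallel> \<ge> \<parallel>f\<parallel>\<^sup>2 max 1 k\<close>.  The double sum over \<open>f\<close> and \<open>k\<close> factors.
\<close>

lemma sum_bases_upto_le_harm:
  "(\<Sum>(f, g)\<in>bases_upto n. 1 / (norm (real_vec f) * norm (real_vec g))) \<le> 24 * harm n * (1 + harm n)"
proof -
  let ?w = "\<lambda>(f, g). 1 / (norm (real_vec f) * norm (real_vec g))"
  define Q where "Q = {(f, g) \<in> bases_upto n. dot2 f f \<le> dot2 g g}"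
  have finQ: "finite Q" unfolding Q_def by (rule finite_subset[OF _ finite_bases_upto]) auto
  \<comment> \<open>The numbering of the bases whose first vector is the shorter one.\<close>
  define \<Phi> where "\<Phi> = (\<lambda>(f, g). (f, nat (dot2 f g div dot2 f f)))"
  define F where "F = {f. f \<noteq> 0 \<and> dot2 f f \<le> int n}"
  have finF: "finite F" unfolding F_def using finite_dot2_le by (rule rev_finite_subset) auto
  have f0: "dot2 f f \<ge> 1" if "det2 f g = 1" for f g
    by (rule dot2_self_pos) (use that in \<open>auto simp: det2_def\<close>)
  have inj: "inj_on \<Phi> Q"
  proof (rule inj_onI, clarify)
    fix f g f' g' assume "(f, g) \<in> Q" "(f', g') \<in> Q" "\<Phi> (f, g) = \<Phi> (f', g')"
    then have *: "f' = f" "det2 f g = 1" "det2 f g' = 1" "dot2 f g \<ge> 0" "dot2 f g' \<ge> 0"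
      "dot2 f g div dot2 f f = dot2 f g' div dot2 f f"
      by (auto simp: \<Phi>_def Q_def bases_upto_def dot2_self_nonneg nat_eq_iff2 pos_imp_zdiv_nonneg_iff dest!: f0)
    have g': "g' = comb2 (det2 g' g) f 1 g" using comb2_det2_coords[of f g 1 g'] * by simp
    have "dot2 f g' = dot2 f g + det2 g' g * dot2 f f"
      by (subst g') (simp add: dot2_def comb2_def algebra_simps)
    then have "dot2 f g' div dot2 f f = dot2 f g div dot2 f f + det2 g' g"
      using f0[OF *(2)] by simp
    then have "det2 g' g = 0" using * by simp
    then have "g' = g" using g' by (simp add: comb2_def)
    then show "f = f' \<and> g = g'" using * by simp
  qed
  have bnd: "\<Phi> (f, g) \<in> F \<times> {..n}" "?w (f, g) \<le> (case \<Phi> (f, g) of (f, k) \<Rightarrow> 1 / dot2 f f * (1 / max 1 (real k)))"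
    if "(f, g) \<in> Q" for f g
  proof -
    have *: "det2 f g = 1" "dot2 f g \<ge> 0" "dot2 f f \<le> int n" "dot2 g g \<le> int n" "dot2 f f \<le> dot2 g g"
      using that by (auto simp: Q_def bases_upto_def)
    define k where "k = dot2 f g div dot2 f f"
    note p = f0[OF *(1)]
    have k0: "k \<ge> 0" using *(2) p by (simp add: k_def pos_imp_zdiv_nonneg_iff)
    have "dot2 f g = k * dot2 f f + dot2 f g mod dot2 f f" using div_mult_mod_eq[of "dot2 f g" "dot2 f f"] by (simp only: k_def)
    moreover have "dot2 f g mod dot2 f f \<ge> 0" using p by (intro pos_mod_sign) auto
    ultimately have k1: "k * dot2 f f \<le> dot2 f g" by linarith
    have cs: "real_of_int (dot2 f g) \<le> norm (real_vec f) * norm (real_vec g)"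
      using norm_cauchy_schwarz[of "real_vec f" "real_vec g"] by (simp add: inner_real_vec)
    have nf: "norm (real_vec f) * norm (real_vec f) = dot2 f f"
      using dot2_self_nonneg[of f] by (simp add: norm_real_vec)
    have ng: "norm (real_vec g) * norm (real_vec g) = dot2 g g"
      using dot2_self_nonneg[of g] by (simp add: norm_real_vec)
    have le: "norm (real_vec f) \<le> norm (real_vec g)" using *(5) by (simp add: norm_real_vec)
    have m1: "real_of_int (dot2 f f) \<le> norm (real_vec f) * norm (real_vec g)"
      using le by (simp add: nf[symmetric] mult_left_mono)
    have m2: "norm (real_vec f) * norm (real_vec g) \<le> real_of_int (dot2 g g)"
      using le by (simp add: ng[symmetric] mult_right_mono)
    have "k \<le> k * dot2 f f" using k0 p by (simp add: mult_le_cancel_left1)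
    then have "k \<le> dot2 f g" using k1 by linarith
    then have "real_of_int k \<le> real_of_int (dot2 g g)" using cs m2 by linarith
    then have "k \<le> int n" using * by linarith
    moreover have "f \<noteq> 0" using p by (auto simp: dot2_def)
    ultimately show "\<Phi> (f, g) \<in> F \<times> {..n}" using * by (auto simp: \<Phi>_def F_def k_def)
    have "dot2 f f * max 1 (real (nat k)) \<le> norm (real_vec f) * norm (real_vec g)"
    proof (cases "k \<ge> 1")
      case True
      have "real_of_int (k * dot2 f f) \<le> norm (real_vec f) * norm (real_vec g)"
        using k1 cs by linarith
      then show ?thesis using True by (simp add: mult.commute)
    next
      case False
      then show ?thesis using m1 k0 by simp
    qed
    then show "?w (f, g) \<le> (case \<Phi> (f, g) of (f, k) \<Rightarrow> 1 / dot2 f f * (1 / max 1 (real k)))"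
      using p by (auto simp: \<Phi>_def k_def intro!: frac_le)
  qed
  have "sum ?w Q \<le> (\<Sum>p\<in>Q. (case \<Phi> p of (f, k) \<Rightarrow> 1 / dot2 f f * (1 / max 1 (real k))))"
    by (rule sum_mono) (use bnd in force)
  also have "\<dots> = (\<Sum>(f, k)\<in>\<Phi> ` Q. 1 / dot2 f f * (1 / max 1 (real k)))"
    using inj by (simp add: sum.reindex)
  also have "\<dots> \<le> (\<Sum>(f, k)\<in>F \<times> {..n}. 1 / dot2 f f * (1 / max 1 (real k)))"
  proof (rule sum_mono2)
    show "\<Phi> ` Q \<subseteq> F \<times> {..n}" using bnd(1) by (metis image_subsetI surj_pair)
  qed (use finF dot2_self_nonneg in \<open>auto intro!: divide_nonneg_nonneg\<close>)
  also have "\<dots> = (\<Sum>f\<in>F. 1 / dot2 f f) * (\<Sum>k\<le>n. 1 / max 1 (real k))"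
    by (simp add: sum_product sum.cartesian_product)
  also have "(\<Sum>k\<le>n. 1 / max 1 (real k)) = 1 + harm n"
  proof -
    have "{..n} = insert 0 {1..n}" by auto
    then show ?thesis by (simp add: harm_def divide_inverse)
  qed
  also have "(\<Sum>f\<in>F. 1 / dot2 f f) * (1 + harm n) \<le> (12 * harm n) * (1 + harm n)"
    using sum_inverse_dot2_le_harm[of n] harm_nonneg[of n, where 'a = real] unfolding F_def
    by (intro mult_right_mono) auto
  finally have 1: "sum ?w Q \<le> 12 * harm n * (1 + harm n)" .
  \<comment> \<open>Reflecting and exchanging the two vectors keeps the determinant and swaps their lengths.\<close>
  define \<sigma> where "\<sigma> = (\<lambda>(f :: int \<times> int, g :: int \<times> int). (prod.swap g, prod.swap f))"
  have inj': "inj_on \<sigma> Q" by (auto simp: inj_on_def \<sigma>_def)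
  have "bases_upto n \<subseteq> Q \<union> \<sigma> ` Q"
  proof clarify
    fix a b c d assume *: "((a, b), (c, d)) \<in> bases_upto n" "((a, b), (c, d)) \<notin> \<sigma> ` Q"
    have "((d, c), (b, a)) \<notin> Q" using *(2) by (force simp: \<sigma>_def)
    then show "((a, b), (c, d)) \<in> Q" using *(1) by (auto simp: Q_def bases_upto_def dot2_def det2_def algebra_simps)
  qed
  then have "sum ?w (bases_upto n) \<le> sum ?w (Q \<union> \<sigma> ` Q)"
    using finQ by (intro sum_mono2) auto
  also have "\<dots> \<le> sum ?w Q + sum ?w (\<sigma> ` Q)"
    using finQ by (subst sum.union_inter[symmetric]) (auto intro!: sum_nonneg)
  also have "sum ?w (\<sigma> ` Q) = sum ?w Q"
    unfolding sum.reindex[OF inj'] by (rule sum.cong) (auto simp: \<sigma>_def norm_real_vec dot2_def algebra_simps)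
  finally show ?thesis using 1 by simp
qed

lemma sum_bases_upto_le_ln:
  assumes R: "R \<ge> 2" and n: "n > 0" "real n \<le> R\<^sup>2"
  shows "(\<Sum>(f, g)\<in>bases_upto n. 1 / (norm (real_vec f) * norm (real_vec g))) \<le> 576 * (ln R)\<^sup>2"
proof -
  have "ln 2 \<le> ln R" using R by simp
  then have L: "ln R \<ge> 1/2" using ln2_ge_two_thirds by linarith
  have "ln (real n) \<le> ln (R\<^sup>2)" using n R by simp
  also have "\<dots> = 2 * ln R" using R by (simp add: ln_realpow)
  finally have H: "harm n \<le> 4 * ln R" "1 + harm n \<le> 6 * ln R"
    using harm_le_one_plus_ln[OF n(1)] L by linarith+
  have "harm n * (1 + harm n) \<le> (4 * ln R) * (6 * ln R)"
    using H L harm_nonneg[of n, where 'a = real] by (intro mult_mono) auto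
  then show ?thesis using sum_bases_upto_le_harm[of n] by (simp add: power2_eq_square)
qed

section \<open>Integration over rotations and translations of the grid\<close>

lemma nn_integral_lborel_pair:
  assumes "g \<in> borel_measurable borel"
  shows "(\<integral>\<^sup>+y. g y \<partial>(lborel :: (real \<times> real) measure)) = (\<integral>\<^sup>+x1. \<integral>\<^sup>+x2. g (x1, x2) \<partial>lborel \<partial>lborel)"
    and "(\<integral>\<^sup>+y. g y \<partial>(lborel :: (real \<times> real) measure)) = (\<integral>\<^sup>+x2. \<integral>\<^sup>+x1. g (x1, x2) \<partial>lborel \<partial>lborel)"
proof -
  have g: "g \<in> borel_measurable (lborel \<Otimes>\<^sub>M lborel)"
    using assms by (simp add: lborel_prod)
  show 1: "(\<integral>\<^sup>+y. g y \<partial>(lborel :: (real \<times> real) measure)) = (\<integral>\<^sup>+x1. \<integral>\<^sup>+x2. g (x1, x2) \<partial>lborel \<partial>lborel)"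
    using lborel.nn_integral_fst[OF g] by (simp add: lborel_prod)
  show "(\<integral>\<^sup>+y. g y \<partial>(lborel :: (real \<times> real) measure)) = (\<integral>\<^sup>+x2. \<integral>\<^sup>+x1. g (x1, x2) \<partial>lborel \<partial>lborel)"
    unfolding 1 using lborel_pair.Fubini'[of "\<lambda>x y. g (x, y)"] g by simp
qed

text \<open>
Two one-dimensional affine substitutions, one in each coordinate, suffice because \<open>\<alpha> \<noteq> 0\<close>.
\<close>

lemma nn_integral_linear_plane:
  fixes g :: "real \<times> real \<Rightarrow> ennreal" and \<alpha> \<beta> \<gamma> \<delta> :: real
  assumes g: "g \<in> borel_measurable borel" and \<alpha>: "\<alpha> \<noteq> 0" and det: "\<alpha> * \<delta> - \<beta> * \<gamma> \<noteq> 0"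
  shows "(\<integral>\<^sup>+y. g y \<partial>lborel) =
    ennreal \<bar>\<alpha> * \<delta> - \<beta> * \<gamma>\<bar> * (\<integral>\<^sup>+y. g (\<alpha> * fst y + \<beta> * snd y, \<gamma> * fst y + \<delta> * snd y) \<partial>lborel)"
proof -
  define c where "c = (\<alpha> * \<delta> - \<beta> * \<gamma>) / \<alpha>"
  have c: "c \<noteq> 0" using \<alpha> det by (simp add: c_def)
  have [measurable]: "g \<in> borel_measurable borel" "g \<in> borel_measurable (borel \<Otimes>\<^sub>M borel)"
    using g by (auto simp: borel_prod)
  have "(\<integral>\<^sup>+y. g y \<partial>lborel) = (\<integral>\<^sup>+X. \<integral>\<^sup>+Y. g (X, Y) \<partial>lborel \<partial>lborel)"
    by (rule nn_integral_lborel_pair(1)[OF g])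
  also have "\<dots> = (\<integral>\<^sup>+X. ennreal \<bar>c\<bar> * (\<integral>\<^sup>+y. g (X, \<gamma> / \<alpha> * X + c * y) \<partial>lborel) \<partial>lborel)"
  proof (rule nn_integral_cong)
    fix X
    have "(\<lambda>Y. g (X, Y)) \<in> borel_measurable borel" by measurable
    then show "(\<integral>\<^sup>+Y. g (X, Y) \<partial>lborel) = ennreal \<bar>c\<bar> * (\<integral>\<^sup>+y. g (X, \<gamma> / \<alpha> * X + c * y) \<partial>lborel)"
      using c by (rule nn_integral_real_affine)
  qed
  also have "\<dots> = ennreal \<bar>c\<bar> * (\<integral>\<^sup>+X. \<integral>\<^sup>+y. g (X, \<gamma> / \<alpha> * X + c * y) \<partial>lborel \<partial>lborel)"
    by (rule nn_integral_cmult) measurable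
  also have "(\<integral>\<^sup>+X. \<integral>\<^sup>+y. g (X, \<gamma> / \<alpha> * X + c * y) \<partial>lborel \<partial>lborel) =
      (\<integral>\<^sup>+y. \<integral>\<^sup>+X. g (X, \<gamma> / \<alpha> * X + c * y) \<partial>lborel \<partial>lborel)"
    by (rule lborel_pair.Fubini') measurable
  also have "\<dots> = (\<integral>\<^sup>+y. ennreal \<bar>\<alpha>\<bar> * (\<integral>\<^sup>+x. g (\<beta> * y + \<alpha> * x, \<gamma> / \<alpha> * (\<beta> * y + \<alpha> * x) + c * y) \<partial>lborel) \<partial>lborel)"
  proof (rule nn_integral_cong)
    fix y
    have "(\<lambda>X. g (X, \<gamma> / \<alpha> * X + c * y)) \<in> borel_measurable borel" by measurable
    then show "(\<integral>\<^sup>+X. g (X, \<gamma> / \<alpha> * X + c * y) \<partial>lborel) =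
        ennreal \<bar>\<alpha>\<bar> * (\<integral>\<^sup>+x. g (\<beta> * y + \<alpha> * x, \<gamma> / \<alpha> * (\<beta> * y + \<alpha> * x) + c * y) \<partial>lborel)"
      using \<alpha> by (rule nn_integral_real_affine)
  qed
  also have "\<dots> = ennreal \<bar>\<alpha>\<bar> * (\<integral>\<^sup>+y. \<integral>\<^sup>+x. g (\<beta> * y + \<alpha> * x, \<gamma> / \<alpha> * (\<beta> * y + \<alpha> * x) + c * y) \<partial>lborel \<partial>lborel)"
    by (rule nn_integral_cmult) measurable
  also have "(\<lambda>y x. g (\<beta> * y + \<alpha> * x, \<gamma> / \<alpha> * (\<beta> * y + \<alpha> * x) + c * y)) = (\<lambda>y x. g (\<alpha> * x + \<beta> * y, \<gamma> * x + \<delta> * y))"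
  proof (intro ext arg_cong[where f = g])
    fix x y :: real
    have "\<gamma> / \<alpha> * (\<beta> * y + \<alpha> * x) + c * y = \<gamma> * x + \<delta> * y"
      using \<alpha> by (simp add: c_def field_simps)
    then show "(\<beta> * y + \<alpha> * x, \<gamma> / \<alpha> * (\<beta> * y + \<alpha> * x) + c * y) = (\<alpha> * x + \<beta> * y, \<gamma> * x + \<delta> * y)"
      by simp
  qed
  also have "(\<integral>\<^sup>+y. \<integral>\<^sup>+x. g (\<alpha> * x + \<beta> * y, \<gamma> * x + \<delta> * y) \<partial>lborel \<partial>lborel) =
     (\<integral>\<^sup>+y. g (\<alpha> * fst y + \<beta> * snd y, \<gamma> * fst y + \<delta> * snd y) \<partial>lborel)"
    by (subst nn_integral_lborel_pair(2)) (auto simp: borel_prod[symmetric])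
  also have "ennreal \<bar>c\<bar> * (ennreal \<bar>\<alpha>\<bar> * (\<integral>\<^sup>+y. g (\<alpha> * fst y + \<beta> * snd y, \<gamma> * fst y + \<delta> * snd y) \<partial>lborel))
     = ennreal \<bar>\<alpha> * \<delta> - \<beta> * \<gamma>\<bar> * (\<integral>\<^sup>+y. g (\<alpha> * fst y + \<beta> * snd y, \<gamma> * fst y + \<delta> * snd y) \<partial>lborel)"
  proof -
    have "\<bar>c\<bar> * \<bar>\<alpha>\<bar> = \<bar>\<alpha> * \<delta> - \<beta> * \<gamma>\<bar>" using \<alpha> by (simp add: c_def abs_divide)
    then have "ennreal \<bar>c\<bar> * ennreal \<bar>\<alpha>\<bar> = ennreal \<bar>\<alpha> * \<delta> - \<beta> * \<gamma>\<bar>" by (simp flip: ennreal_mult)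
    then show ?thesis by (simp only: mult.assoc[symmetric])
  qed
  finally show ?thesis .
qed

lemma continuous_on_rot [continuous_intros]:
  fixes S :: "'a::t2_space set"
  assumes "continuous_on S f" "continuous_on S g"
  shows "continuous_on S (\<lambda>x. rot (f x) (g x))"
  unfolding rot_def by (intro continuous_intros assms)

lemma nn_integral_rot:
  assumes g: "g \<in> borel_measurable borel"
  shows "(\<integral>\<^sup>+y. g (rot \<theta> y) \<partial>lborel) = (\<integral>\<^sup>+y. g y \<partial>lborel)"
proof -
  have *: "(\<integral>\<^sup>+y. g (rot \<theta> y) \<partial>lborel) = (\<integral>\<^sup>+y. g y \<partial>lborel)"
    if "cos \<theta> \<noteq> 0" "g \<in> borel_measurable borel" for \<theta> g
  proof -
    have d: "cos \<theta> * cos \<theta> - (- sin \<theta>) * sin \<theta> = 1" by simp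
    show ?thesis
      using nn_integral_linear_plane[OF that(2,1), of "cos \<theta>" "- sin \<theta>" "sin \<theta>"] d by (simp add: rot_def)
  qed
  show ?thesis
  proof (cases "cos \<theta> = 0")
    case False
    then show ?thesis using * g by blast
  next
    case True
    \<comment> \<open>A quarter turn is the square of a rotation whose cosine does not vanish.\<close>
    have c: "cos (\<theta> / 2) \<noteq> 0" using True cos_double_cos[of "\<theta> / 2"] by auto
    have r: "rot \<theta> y = rot (\<theta> / 2) (rot (\<theta> / 2) y)" for y
    proof -
      have *: "sin \<theta> = 2 * (sin (\<theta> / 2) * cos (\<theta> / 2))"
        "cos \<theta> = cos (\<theta> / 2) * cos (\<theta> / 2) - sin (\<theta> / 2) * sin (\<theta> / 2)"
        using sin_add[of "\<theta>/2" "\<theta>/2"] cos_add[of "\<theta>/2" "\<theta>/2"] by simp_all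
      show ?thesis by (simp add: rot_def * algebra_simps)
    qed
    have "continuous_on UNIV (rot (\<theta> / 2))" by (intro continuous_intros)
    then have "rot (\<theta> / 2) \<in> borel_measurable borel" by (rule borel_measurable_continuous_onI)
    then have "(\<lambda>y. g (rot (\<theta> / 2) y)) \<in> borel_measurable borel" using g by measurable
    then show ?thesis unfolding r using *[OF c g] *[OF c, of "\<lambda>y. g (rot (\<theta> / 2) y)"] by simp
  qed
qed

lemma nn_integral_scaled_rot:
  assumes g: "g \<in> borel_measurable borel" and h: "h > 0"
  shows "(\<integral>\<^sup>+y. g (h *\<^sub>R rot \<theta> y) \<partial>lborel) = ennreal (1 / h\<^sup>2) * (\<integral>\<^sup>+y. g y \<partial>lborel)"
proof -
  have "(\<integral>\<^sup>+y. g y \<partial>lborel) = ennreal (h\<^sup>2) * (\<integral>\<^sup>+y. g (h *\<^sub>R y) \<partial>lborel)"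
    using nn_integral_linear_plane[OF g, of h h 0 0] h by (simp add: scaleR_prod_def power2_eq_square)
  then have "ennreal (1 / h\<^sup>2) * (\<integral>\<^sup>+y. g y \<partial>lborel) = (ennreal (1 / h\<^sup>2) * ennreal (h\<^sup>2)) * (\<integral>\<^sup>+y. g (h *\<^sub>R y) \<partial>lborel)"
    by (simp only: mult.assoc)
  also have "ennreal (1 / h\<^sup>2) * ennreal (h\<^sup>2) = 1"
    using h by (simp flip: ennreal_mult)
  also have "1 * (\<integral>\<^sup>+y. g (h *\<^sub>R y) \<partial>lborel) = (\<integral>\<^sup>+y. g (h *\<^sub>R rot \<theta> y) \<partial>lborel)"
    using nn_integral_rot[of "\<lambda>y. g (h *\<^sub>R y)" \<theta>] g by simp
  finally show ?thesis by simp
qed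

lemma nn_integral_translate:
  fixes g :: "real \<times> real \<Rightarrow> ennreal"
  assumes [measurable]: "g \<in> borel_measurable borel"
  shows "(\<integral>\<^sup>+y. g (y + c) \<partial>lborel) = (\<integral>\<^sup>+y. g y \<partial>lborel)"
proof -
  have "(\<integral>\<^sup>+y. g y \<partial>lborel) = (\<integral>\<^sup>+y. g y \<partial>distr lborel borel ((+) c))"
    by (simp add: lborel_distr_plus)
  also have "\<dots> = (\<integral>\<^sup>+y. g (c + y) \<partial>lborel)"
    by (rule nn_integral_distr) auto
  finally show ?thesis by (simp add: add.commute)
qed

text \<open>
The lattice translates of the open unit square are disjoint, and the closed square exceeds the open one by
a null set.
\<close>

lemma nn_integral_unit_square_le:
  fixes g :: "real \<times> real \<Rightarrow> ennreal"
  assumes g[measurable]: "g \<in> borel_measurable borel" and A: "finite A"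
  shows "(\<integral>\<^sup>+\<xi>\<in>{0..1} \<times> {0..1}. (\<Sum>k\<in>A. g (\<xi> + real_vec k)) \<partial>lborel) \<le> (\<integral>\<^sup>+y. g y \<partial>lborel)"
proof -
  define B :: "(real \<times> real) set" where "B = {0<..<1} \<times> {0<..<1}"
  have [measurable]: "B \<in> sets borel" unfolding B_def by (intro borel_open open_Times) auto
  have "negligible (cbox (0::real \<times> real) (1,1) - box 0 (1,1))" by (rule negligible_frontier_interval)
  moreover have "cbox (0::real \<times> real) (1,1) = {0..1} \<times> {0..1}" "box (0::real \<times> real) (1,1) = B"
    by (auto simp: B_def mem_box Basis_prod_def zero_prod_def cbox_Pair_eq)
  ultimately have "negligible ({0..1} \<times> {0..1} - B)" by simp
  then have "AE \<xi> in lebesgue. \<xi> \<notin> {0..1} \<times> {0..1} - B"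
    by (intro AE_not_in) (simp add: negligible_iff_null_sets)
  then have "(\<integral>\<^sup>+\<xi>\<in>{0..1} \<times> {0..1}. (\<Sum>k\<in>A. g (\<xi> + real_vec k)) \<partial>lebesgue)
      \<le> (\<integral>\<^sup>+\<xi>. (\<Sum>k\<in>A. g (\<xi> + real_vec k)) * indicator B \<xi> \<partial>lebesgue)"
    by (intro nn_integral_mono_AE, eventually_elim) (auto split: split_indicator)
  then have "(\<integral>\<^sup>+\<xi>\<in>{0..1} \<times> {0..1}. (\<Sum>k\<in>A. g (\<xi> + real_vec k)) \<partial>lborel)
      \<le> (\<integral>\<^sup>+\<xi>. (\<Sum>k\<in>A. g (\<xi> + real_vec k) * indicator B \<xi>) \<partial>lborel)"
    by (simp add: nn_integral_completion sum_distrib_right)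
  also have "\<dots> = (\<Sum>k\<in>A. \<integral>\<^sup>+\<xi>. g (\<xi> + real_vec k) * indicator B \<xi> \<partial>lborel)"
    by (rule nn_integral_sum) measurable
  also have "\<dots> = (\<Sum>k\<in>A. \<integral>\<^sup>+y. g y * indicator B (y - real_vec k) \<partial>lborel)"
  proof (rule sum.cong[OF refl])
    fix k
    show "(\<integral>\<^sup>+\<xi>. g (\<xi> + real_vec k) * indicator B \<xi> \<partial>lborel) = (\<integral>\<^sup>+y. g y * indicator B (y - real_vec k) \<partial>lborel)"
      using nn_integral_translate[of "\<lambda>y. g y * indicator B (y - real_vec k)" "real_vec k"] by simp
  qed
  also have "\<dots> = (\<integral>\<^sup>+y. (\<Sum>k\<in>A. g y * indicator B (y - real_vec k)) \<partial>lborel)"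
    by (rule nn_integral_sum[symmetric]) measurable
  also have "\<dots> \<le> (\<integral>\<^sup>+y. g y \<partial>lborel)"
  proof (rule nn_integral_mono)
    fix y :: "real \<times> real"
    have "(\<Sum>k\<in>A. indicator B (y - real_vec k)) \<le> (1::ennreal)"
    proof (cases "\<exists>k\<in>A. y - real_vec k \<in> B")
      case True
      then obtain k where k: "k \<in> A" "y - real_vec k \<in> B" by blast
      have "k' = k" if "y - real_vec k' \<in> B" for k'
      proof -
        have "real_of_int (fst k') < fst k + 1" "real_of_int (fst k) < fst k' + 1"
             "real_of_int (snd k') < snd k + 1" "real_of_int (snd k) < snd k' + 1"
          using that k by (auto simp: B_def real_vec_def mem_Times_iff)
        then have "fst k' = fst k" "snd k' = snd k" by linarith+
        then show ?thesis by (rule prod_eqI)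
      qed
      then have "(\<Sum>k\<in>A. indicator B (y - real_vec k)) = (\<Sum>k'\<in>A. if k' = k then 1 else (0::ennreal))"
        using k(2) by (intro sum.cong refl) (metis indicator_simps)
      then show ?thesis using A k by simp
    next
      case False
      then have "(\<Sum>k\<in>A. indicator B (y - real_vec k)) = (0::ennreal)"
        by (intro sum.neutral ballI) (metis indicator_simps(2))
      then show ?thesis by simp
    qed
    then have "g y * (\<Sum>k\<in>A. indicator B (y - real_vec k)) \<le> g y * 1" by (rule mult_left_mono) simp
    then show "(\<Sum>k\<in>A. g y * indicator B (y - real_vec k)) \<le> g y"
      by (simp only: sum_distrib_left mult_1_right)
  qed
  finally show ?thesis .
qed

section \<open>Counting directions by flipped diagonals\<close>

text \<open>
On the interior of \<open>\<Omega>\<close> the convex function \<open>U\<close> is continuous.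
\<close>

lemma open_flip_set:
  assumes U: "convex_on \<Omega> U" and \<Omega>: "closed \<Omega>"
  shows "open (flip_set \<Omega> U a b)"
proof -
  let ?I = "interior \<Omega>"
  let ?at = "\<lambda>v p. snd p + rot (fst p) v"
  have cont: "continuous_on S (?at v)" for v and S :: "(real \<times> (real \<times> real)) set"
    by (intro continuous_intros)
  have op: "open (?at v -` W)" if "open W" for v W
    using open_vimage[OF that cont] by simp
  have UI: "continuous_on ?I U"
    by (intro convex_on_continuous convex_on_subset[OF U] interior_subset convex_interior convex_on_imp_convex[OF U]) auto
  have Uc: "continuous_on S (\<lambda>p. U (?at v p))" if "S \<subseteq> ?at v -` ?I" for v S
    by (rule continuous_on_compose2[OF UI cont]) (use that in auto)
  define A where "A = ?at a -` ?I \<inter> ?at (- a) -` ?I"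
  define B where "B = ?at b -` ?I \<inter> ?at (- b) -` ?I"
  define F where "F = (\<lambda>p. U (?at b p) + U (?at (- b) p) - (U (?at a p) + U (?at (- a) p)))"
  have "open (A \<inter> B)" by (auto simp: A_def B_def intro!: op)
  moreover have "continuous_on (A \<inter> B) F"
    unfolding F_def by (intro continuous_on_add continuous_on_diff Uc) (auto simp: A_def B_def)
  ultimately have o1: "open (A \<inter> B \<inter> F -` {0<..})" by (intro continuous_open_preimage) auto
  have o2: "open (A \<inter> (?at b -` (- \<Omega>) \<union> ?at (- b) -` (- \<Omega>)))"
    using \<Omega> by (auto simp: A_def intro!: op open_Int open_Un)
  have eq: "flip_set \<Omega> U a b = A \<inter> (?at b -` (- \<Omega>) \<union> ?at (- b) -` (- \<Omega>)) \<union> (A \<inter> B \<inter> F -` {0<..})"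
    by (auto simp: flip_set_def A_def B_def F_def rot_minus)
  show ?thesis unfolding eq by (intro open_Un o1 o2)
qed

lemma closed_edge_set: "closed (edge_set \<Omega> a b)"
proof -
  let ?at = "\<lambda>v (p :: real \<times> (real \<times> real)). snd p + rot (fst p) v"
  have cont: "continuous_on UNIV (?at v)" for v
    by (intro continuous_intros)
  have "closed (\<Union>v\<in>{a, - a, b, - b}. ?at v -` frontier \<Omega>)"
    by (intro closed_UN ballI closed_vimage[OF frontier_closed cont]) auto
  moreover have "edge_set \<Omega> a b = (\<Union>v\<in>{a, - a, b, - b}. ?at v -` frontier \<Omega>)"
    by (auto simp: edge_set_def)
  ultimately show ?thesis by simp
qed

lemma edge_set_null:
  assumes "convex \<Omega>"
  shows "(\<integral>\<^sup>+m. indicator (edge_set \<Omega> a b) (\<theta>, m) \<partial>lborel) = 0"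
proof -
  have "negligible (\<Union>v\<in>{a, - a, b, - b}. (+) (- rot \<theta> v) ` frontier \<Omega>)"
  proof (rule negligible_Union)
    have "negligible ((+) (- rot \<theta> v) ` frontier \<Omega>)" for v
      by (intro negligible_translation negligible_convex_frontier assms)
    then show "negligible T" if "T \<in> (\<lambda>v. (+) (- rot \<theta> v) ` frontier \<Omega>) ` {a, - a, b, - b}" for T
      using that by blast
  qed simp
  moreover have "{m. (\<theta>, m) \<in> edge_set \<Omega> a b} = (\<Union>v\<in>{a, - a, b, - b}. (+) (- rot \<theta> v) ` frontier \<Omega>)"
    by (force simp: edge_set_def image_iff algebra_simps)
  ultimately have "AE m in lebesgue. m \<notin> {m. (\<theta>, m) \<in> edge_set \<Omega> a b}"
    by (intro AE_not_in) (simp add: negligible_iff_null_sets)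
  then have "(\<integral>\<^sup>+m. indicator (edge_set \<Omega> a b) (\<theta>, m) \<partial>lebesgue) = (\<integral>\<^sup>+m. 0 \<partial>(lebesgue :: (real \<times> real) measure))"
    by (intro nn_integral_cong_AE, eventually_elim) (auto split: split_indicator)
  then show ?thesis by (simp add: nn_integral_completion)
qed

text \<open>
The half-diagonals of the parallelogram spanned by \<open>h\<close> times the two vectors of \<open>p\<close>.
\<close>

definition half_sum :: "real \<Rightarrow> (int \<times> int) \<times> (int \<times> int) \<Rightarrow> real \<times> real" where
  "half_sum h p = (h / 2) *\<^sub>R real_vec (fst p + snd p)"

definition half_diff :: "real \<Rightarrow> (int \<times> int) \<times> (int \<times> int) \<Rightarrow> real \<times> real" where
  "half_diff h p = (h / 2) *\<^sub>R (real_vec (fst p) - real_vec (snd p))"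

lemma half_sum_diff:
  "half_sum h (f, g) + half_diff h (f, g) = h *\<^sub>R real_vec f"
  "half_sum h (f, g) - half_diff h (f, g) = h *\<^sub>R real_vec g"
  by (simp_all add: half_sum_def half_diff_def real_vec_add algebra_simps flip: scaleR_add_left)

definition flips :: "real \<Rightarrow> (real \<times> real) set \<Rightarrow> (real \<times> real \<Rightarrow> real) \<Rightarrow> (int \<times> int) \<times> (int \<times> int)
    \<Rightarrow> (real \<times> (real \<times> real)) set" where
  "flips h \<Omega> U p = flip_set \<Omega> U (half_sum h p) (half_diff h p) \<union> edge_set \<Omega> (half_sum h p) (half_diff h p)"

text \<open>
The ends of the diagonals of the parallelogram \<open>x\<close>, \<open>x \<oplus> f\<close>, \<open>x \<oplus> e\<close>, \<open>x \<oplus> g\<close> are its four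
vertices, and both diagonals have the same midpoint.  Using the midpoint rather than \<open>x\<close> is what
makes the angles for a fixed point comparable.
\<close>

lemma needed_imp_flips:
  assumes p: "parents e f g" and e: "e \<in> needed h \<theta> \<Omega> U x" and x: "x \<in> \<Omega>"
  shows "(\<theta>, x + rot \<theta> (half_sum h (f, g))) \<in> flips h \<Omega> U (f, g)"
proof (rule ccontr)
  assume neg: "\<not> ?thesis"
  define a b where "a = half_sum h (f, g)" and "b = half_diff h (f, g)"
  define m where "m = x + rot \<theta> a"
  have pts: "m + rot \<theta> a = lattice_view h \<theta> x (real_vec e)" "m - rot \<theta> a = x"
    "m + rot \<theta> b = lattice_view h \<theta> x (real_vec f)" "m - rot \<theta> b = lattice_view h \<theta> x (real_vec g)"
  proof -
    have "real_vec e = real_vec f + real_vec g" using p by (simp add: parents_iff real_vec_add)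
    then show "m + rot \<theta> a = lattice_view h \<theta> x (real_vec e)"
      using half_sum_diff[of h f g] unfolding m_def a_def lattice_view_def
      by (simp add: half_sum_def real_vec_add rot_scaleR flip: scaleR_add_left)
    show "m - rot \<theta> a = x" by (simp add: m_def)
    have "rot \<theta> a + rot \<theta> b = h *\<^sub>R rot \<theta> (real_vec f)" "rot \<theta> a - rot \<theta> b = h *\<^sub>R rot \<theta> (real_vec g)"
      using half_sum_diff[of h f g] by (simp_all add: a_def b_def flip: rot_add rot_diff rot_scaleR)
    then show "m + rot \<theta> b = lattice_view h \<theta> x (real_vec f)" "m - rot \<theta> b = lattice_view h \<theta> x (real_vec g)"
      by (simp_all add: m_def lattice_view_def algebra_simps)
  qed
  have e': "lattice_view h \<theta> x (real_vec e) \<in> \<Omega>" "\<not> superfluous (lattice_view h \<theta> x -` \<Omega>) (\<lambda>v. U (lattice_view h \<theta> x v)) e"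
    using e by (auto simp: needed_def necessary_def)
  have fr: "q \<notin> frontier \<Omega>" if "q \<in> {m + rot \<theta> a, m - rot \<theta> a, m + rot \<theta> b, m - rot \<theta> b}" for q
    using neg that unfolding flips_def edge_set_def m_def a_def b_def by (auto simp: rot_minus)
  have int: "q \<in> interior \<Omega>" if "q \<in> {m + rot \<theta> a, m - rot \<theta> a, m + rot \<theta> b, m - rot \<theta> b}" "q \<in> \<Omega>" for q
    using fr[OF that(1)] that(2) closure_subset[of \<Omega>] by (auto simp: frontier_def)
  have ab: "m + rot \<theta> a \<in> interior \<Omega>" "m - rot \<theta> a \<in> interior \<Omega>"
    using int[of "m + rot \<theta> a"] int[of "m - rot \<theta> a"] e' x pts by auto
  have nf: "(\<theta>, m) \<notin> flip_set \<Omega> U a b" using neg by (simp add: flips_def m_def a_def b_def)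
  then have bb: "m + rot \<theta> b \<in> \<Omega>" "m - rot \<theta> b \<in> \<Omega>" using ab by (auto simp: flip_set_def)
  then have "U (m + rot \<theta> b) + U (m - rot \<theta> b) \<le> U (m + rot \<theta> a) + U (m - rot \<theta> a)"
    using nf ab int[of "m + rot \<theta> b"] int[of "m - rot \<theta> b"] by (auto simp: flip_set_def)
  then have "superfluous (lattice_view h \<theta> x -` \<Omega>) (\<lambda>v. U (lattice_view h \<theta> x v)) e"
    using bb unfolding pts by (intro superfluousI[OF p]) (simp_all del: pts(2))
  then show False using e' by blast
qed

text \<open>
A majorant of the cardinality of the minimal stencil at \<open>x\<close> that is Borel measurable in \<open>\<theta>\<close> and \<open>x\<close>
jointly, so that the order of integration may be exchanged.  The summand 4 accounts for the unit vectors.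
\<close>

definition count_bound :: "real \<Rightarrow> nat \<Rightarrow> (real \<times> real) set \<Rightarrow> (real \<times> real \<Rightarrow> real) \<Rightarrow> real \<Rightarrow> real \<times> real \<Rightarrow> ennreal" where
  "count_bound h n \<Omega> U \<theta> x = 4 * indicator \<Omega> x +
     (\<Sum>p\<in>bases_upto n. indicator (flips h \<Omega> U p) (\<theta>, x + rot \<theta> (half_sum h p)))"

lemma card_needed_le:
  assumes x: "x \<in> \<Omega>" and h: "h > 0" and d: "\<And>y. y \<in> \<Omega> \<Longrightarrow> dist x y \<le> d"
  shows "of_nat (card (needed h \<theta> \<Omega> U x)) \<le> count_bound h (nat \<lfloor>(d / h)\<^sup>2\<rfloor>) \<Omega> U \<theta> x"
proof -
  define n where "n = nat \<lfloor>(d / h)\<^sup>2\<rfloor>"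
  define S :: "(int \<times> int) set" where "S = {(1,0),(-1,0),(0,1),(0,-1)}"
  define P where "P = {p \<in> bases_upto n. (\<theta>, x + rot \<theta> (half_sum h p)) \<in> flips h \<Omega> U p}"
  have finP: "finite P" unfolding P_def using finite_bases_upto by auto
  have "needed h \<theta> \<Omega> U x \<subseteq> S \<union> (\<lambda>p. fst p + snd p) ` P"
  proof
    fix e assume e: "e \<in> needed h \<theta> \<Omega> U x"
    show "e \<in> S \<union> (\<lambda>p. fst p + snd p) ` P"
    proof (cases "e \<in> S")
      case False
      have "irreducible_vec e" using e by (simp add: needed_def necessary_def)
      then obtain f g where p: "parents e f g" using unit_or_parents False unfolding S_def by blast
      have "lattice_view h \<theta> x (real_vec e) \<in> \<Omega>" using e by (simp add: needed_def necessary_def)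
      from d[OF this] have "h * norm (real_vec e) \<le> d"
        using h by (simp add: lattice_view_def dist_norm)
      then have "norm (real_vec e) \<le> d / h" using h by (simp add: field_simps)
      then have "(norm (real_vec e))\<^sup>2 \<le> (d / h)\<^sup>2" by (intro power_mono) auto
      then have "dot2 e e \<le> \<lfloor>(d / h)\<^sup>2\<rfloor>"
        using dot2_self_nonneg[of e] by (simp add: norm_real_vec le_floor_iff)
      then have "dot2 e e \<le> int n" by (simp add: n_def)
      then have "(f, g) \<in> bases_upto n"
        using dot2_self_gt_parents[OF p] p by (auto simp: bases_upto_def parents_iff)
      then have "(f, g) \<in> P" using needed_imp_flips[OF p e x] by (simp add: P_def)
      then show ?thesis using p by (force simp: parents_iff)
    qed simp
  qed
  then have "card (needed h \<theta> \<Omega> U x) \<le> card (S \<union> (\<lambda>p. fst p + snd p) ` P)"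
    using finP by (intro card_mono) (auto simp: S_def)
  also have "\<dots> \<le> card S + card ((\<lambda>p. fst p + snd p) ` P)" by (rule card_Un_le)
  also have "\<dots> \<le> 4 + card P"
    using card_image_le[OF finP, of "\<lambda>p. fst p + snd p"] by (simp add: S_def)
  finally have "of_nat (card (needed h \<theta> \<Omega> U x)) \<le> (of_nat (4 + card P) :: ennreal)"
    by (rule of_nat_mono)
  also have "\<dots> = 4 + of_nat (card P)" by simp
  also have "of_nat (card P) = (\<Sum>p\<in>bases_upto n. indicator (flips h \<Omega> U p) (\<theta>, x + rot \<theta> (half_sum h p)) :: ennreal)"
  proof -
    have "(\<Sum>p\<in>bases_upto n. indicator (flips h \<Omega> U p) (\<theta>, x + rot \<theta> (half_sum h p)) :: ennreal) = (\<Sum>p\<in>P. 1)"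
      by (rule sum.mono_neutral_cong_right)
         (auto simp: P_def finite_bases_upto split: split_indicator)
    then show ?thesis by simp
  qed
  finally show ?thesis using x by (simp add: count_bound_def n_def)
qed

lemma stencils_card_le_sum_count_bound:
  assumes h: "h > 0" and U: "convex_on \<Omega> U" and d: "\<And>x y. x \<in> \<Omega> \<Longrightarrow> y \<in> \<Omega> \<Longrightarrow> dist x y \<le> d"
    and A: "finite A" "\<And>k. h *\<^sub>R rot \<theta> (\<xi> + real_vec k) \<in> \<Omega> \<Longrightarrow> k \<in> A"
  shows "of_nat (stencils_card (grid_points \<Omega> h \<theta> \<xi>) (minimal_stencils h \<theta> (grid_points \<Omega> h \<theta> \<xi>) U))
     \<le> (\<Sum>k\<in>A. count_bound h (nat \<lfloor>(d / h)\<^sup>2\<rfloor>) \<Omega> U \<theta> (h *\<^sub>R rot \<theta> (\<xi> + real_vec k)))"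
proof -
  let ?pt = "\<lambda>k. h *\<^sub>R rot \<theta> (\<xi> + real_vec k)"
  let ?c = "\<lambda>x. count_bound h (nat \<lfloor>(d / h)\<^sup>2\<rfloor>) \<Omega> U \<theta> x"
  define X where "X = grid_points \<Omega> h \<theta> \<xi>"
  define B where "B = {k \<in> A. ?pt k \<in> \<Omega>}"
  have X: "X = ?pt ` B" using A(2) by (auto simp: X_def grid_points_def B_def)
  have "of_nat (stencils_card X (minimal_stencils h \<theta> X U)) = (\<Sum>x\<in>X. of_nat (card (needed h \<theta> \<Omega> U x)) :: ennreal)"
    unfolding stencils_card_def of_nat_sum by (intro sum.cong) (auto simp: X_def minimal_stencils_eq[OF U])
  also have "\<dots> \<le> (\<Sum>x\<in>X. ?c x)"
    by (intro sum_mono card_needed_le h d) (auto simp: X_def grid_points_def)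
  also have "\<dots> \<le> (\<Sum>k\<in>B. ?c (?pt k))"
    using sum_image_le[of B ?c ?pt] A(1) by (simp add: X B_def o_def)
  also have "\<dots> \<le> (\<Sum>k\<in>A. ?c (?pt k))"
    using A(1) by (intro sum_mono2) (auto simp: B_def)
  finally show ?thesis by (simp add: X_def)
qed

lemma measurable_flip_set:
  assumes "convex_on \<Omega> U" "closed \<Omega>"
  shows "flip_set \<Omega> U a b \<in> sets (borel \<Otimes>\<^sub>M borel)"
  unfolding borel_prod by (intro borel_open open_flip_set assms)

lemma measurable_flips:
  assumes "convex_on \<Omega> U" "closed \<Omega>"
  shows "flips h \<Omega> U p \<in> sets borel"
  unfolding flips_def by (intro sets.Un borel_open open_flip_set assms borel_closed closed_edge_set)

lemma measurable_count_bound: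
  assumes "convex_on \<Omega> U" "closed \<Omega>"
  shows "(\<lambda>q. count_bound h n \<Omega> U (fst q) (snd q)) \<in> borel_measurable borel"
proof -
  have "(\<lambda>q :: real \<times> real \<times> real. (fst q, snd q + rot (fst q) v)) \<in> borel_measurable borel" for v
    by (intro borel_measurable_continuous_onI continuous_intros)
  then have "(\<lambda>q. indicator (flips h \<Omega> U p) (fst q, snd q + rot (fst q) v) :: ennreal) \<in> borel_measurable borel" for p v
    using measurable_flips[OF assms] by measurable
  moreover have "(\<lambda>q :: real \<times> real \<times> real. snd q) \<in> borel_measurable borel"
    by (intro borel_measurable_continuous_onI continuous_intros)
  then have "(\<lambda>q :: real \<times> real \<times> real. indicator \<Omega> (snd q) :: ennreal) \<in> borel_measurable borel"
    using borel_closed[OF assms(2)] by measurable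
  ultimately show ?thesis unfolding count_bound_def by (intro borel_measurable_add borel_measurable_sum borel_measurable_times) auto
qed

lemma nn_integral_count_bound_le:
  assumes U: "convex_on \<Omega> U" and \<Omega>: "closed \<Omega>"
  shows "(\<integral>\<^sup>+x. count_bound h n \<Omega> U \<theta> x \<partial>lborel) \<le> 4 * emeasure lborel \<Omega> +
     (\<Sum>p\<in>bases_upto n. \<integral>\<^sup>+m. indicator (flip_set \<Omega> U (half_sum h p) (half_diff h p)) (\<theta>, m) \<partial>lborel)"
proof -
  have [measurable]: "\<Omega> \<in> sets borel" using \<Omega> by (rule borel_closed)
  have sec: "(\<lambda>m. indicator S (\<theta>, m) :: ennreal) \<in> borel_measurable borel" if "S \<in> sets borel" for S :: "(real \<times> (real \<times> real)) set"
    using measurable_compose[OF _ borel_measurable_indicator[OF that], of "\<lambda>m. (\<theta>, m)" borel]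
    by (auto simp: borel_prod[symmetric])
  have mf: "(\<lambda>m. indicator (flips h \<Omega> U p) (\<theta>, m) :: ennreal) \<in> borel_measurable borel" for p
    by (rule sec[OF measurable_flips[OF U \<Omega>]])
  have mf': "(\<lambda>m. indicator (flips h \<Omega> U p) (\<theta>, m + c) :: ennreal) \<in> borel_measurable borel" for p c
    using mf by measurable
  have "(\<integral>\<^sup>+x. count_bound h n \<Omega> U \<theta> x \<partial>lborel) = 4 * emeasure lborel \<Omega> +
     (\<Sum>p\<in>bases_upto n. \<integral>\<^sup>+x. indicator (flips h \<Omega> U p) (\<theta>, x + rot \<theta> (half_sum h p)) \<partial>lborel)"
    unfolding count_bound_def using mf'
    by (subst nn_integral_add) (auto simp: nn_integral_sum nn_integral_cmult)
  also have "\<dots> = 4 * emeasure lborel \<Omega> + (\<Sum>p\<in>bases_upto n. \<integral>\<^sup>+m. indicator (flips h \<Omega> U p) (\<theta>, m) \<partial>lborel)"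
    using nn_integral_translate[OF mf] by simp
  also have "\<dots> \<le> 4 * emeasure lborel \<Omega> +
     (\<Sum>p\<in>bases_upto n. \<integral>\<^sup>+m. indicator (flip_set \<Omega> U (half_sum h p) (half_diff h p)) (\<theta>, m) \<partial>lborel)"
  proof (intro add_left_mono sum_mono)
    fix p
    let ?a = "half_sum h p" and ?b = "half_diff h p"
    have "(\<integral>\<^sup>+m. indicator (flips h \<Omega> U p) (\<theta>, m) \<partial>lborel) \<le>
        (\<integral>\<^sup>+m. indicator (flip_set \<Omega> U ?a ?b) (\<theta>, m) + indicator (edge_set \<Omega> ?a ?b) (\<theta>, m) \<partial>lborel)"
      by (intro nn_integral_mono) (auto simp: flips_def split: split_indicator)
    also have "\<dots> = (\<integral>\<^sup>+m. indicator (flip_set \<Omega> U ?a ?b) (\<theta>, m) \<partial>lborel) + (\<integral>\<^sup>+m. indicator (edge_set \<Omega> ?a ?b) (\<theta>, m) \<partial>lborel)"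
      by (intro nn_integral_add)
         (simp_all add: sec borel_open[OF open_flip_set[OF U \<Omega>]] borel_closed[OF closed_edge_set])
    finally show "(\<integral>\<^sup>+m. indicator (flips h \<Omega> U p) (\<theta>, m) \<partial>lborel) \<le> (\<integral>\<^sup>+m. indicator (flip_set \<Omega> U ?a ?b) (\<theta>, m) \<partial>lborel)"
      by (simp add: edge_set_null convex_on_imp_convex[OF U])
  qed
  finally show ?thesis .
qed

text \<open>
With the integral over the angles on the inside, the bound for a fixed midpoint applies; only midpoints
in \<open>\<Omega>\<close> contribute, as they are halfway between two points of \<open>\<Omega>\<close>.
\<close>

lemma nn_integral_flip_set_le:
  assumes U: "convex_on \<Omega> U" and \<Omega>: "closed \<Omega>" and h: "h > 0" and p: "(f, g) \<in> bases_upto n"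
  defines "F \<equiv> flip_set \<Omega> U (half_sum h (f, g)) (half_diff h (f, g))"
  shows "(\<integral>\<^sup>+\<theta>\<in>{0..pi/2}. (\<integral>\<^sup>+m. indicator F (\<theta>, m) \<partial>lborel) \<partial>lborel)
     \<le> ennreal (8 / (norm (real_vec f) * norm (real_vec g))) * emeasure lborel \<Omega>"
proof -
  have fg: "det2 f g = 1" "dot2 f g \<ge> 0" using p by (auto simp: bases_upto_def)
  have [measurable]: "F \<in> sets (borel \<Otimes>\<^sub>M borel)" unfolding F_def by (rule measurable_flip_set[OF U \<Omega>])
  have [measurable]: "\<Omega> \<in> sets borel" using \<Omega> by (rule borel_closed)
  have mid: "m \<in> \<Omega>" if "(\<theta>, m) \<in> F" for \<theta> m
  proof -
    let ?r = "rot \<theta> (half_sum h (f, g))"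
    have "m + ?r \<in> \<Omega>" "m - ?r \<in> \<Omega>"
      using that interior_subset[of \<Omega>] by (auto simp: F_def flip_set_def)
    then have "(1/2) *\<^sub>R (m + ?r) + (1/2) *\<^sub>R (m - ?r) \<in> \<Omega>"
      by (intro convexD[OF convex_on_imp_convex[OF U]]) auto
    moreover have "(1/2) *\<^sub>R (m + ?r) + (1/2) *\<^sub>R (m - ?r) = m"
      by (simp add: algebra_simps flip: scaleR_add_left)
    ultimately show ?thesis by simp
  qed
  have "(\<integral>\<^sup>+\<theta>\<in>{0..pi/2}. (\<integral>\<^sup>+m. indicator F (\<theta>, m) \<partial>lborel) \<partial>lborel)
      = (\<integral>\<^sup>+\<theta>. (\<integral>\<^sup>+m. indicator F (\<theta>, m) * indicator {0..pi/2} \<theta> \<partial>lborel) \<partial>lborel)"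
    by (intro nn_integral_cong nn_integral_multc[symmetric]) measurable
  also have "\<dots> = (\<integral>\<^sup>+m. (\<integral>\<^sup>+\<theta>. indicator F (\<theta>, m) * indicator {0..pi/2} \<theta> \<partial>lborel) \<partial>lborel)"
    by (rule lborel_pair.Fubini'[symmetric]) measurable
  also have "\<dots> \<le> (\<integral>\<^sup>+m. ennreal (8 / (norm (real_vec f) * norm (real_vec g))) * indicator \<Omega> m \<partial>lborel)"
  proof (rule nn_integral_mono)
    fix m
    show "(\<integral>\<^sup>+\<theta>. indicator F (\<theta>, m) * indicator {0..pi/2} \<theta> \<partial>lborel) \<le>
       ennreal (8 / (norm (real_vec f) * norm (real_vec g))) * indicator \<Omega> m"
    proof (cases "m \<in> \<Omega>")
      case True
      then show ?thesis
        using nn_integral_flip_angles_basis_le[OF U fg h, of m] by (simp add: F_def half_sum_def half_diff_def)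
    next
      case False
      then have "(\<theta>, m) \<notin> F" for \<theta> using mid by blast
      then show ?thesis by (simp add: indicator_def)
    qed
  qed
  also have "\<dots> = ennreal (8 / (norm (real_vec f) * norm (real_vec g))) * emeasure lborel \<Omega>"
    by (simp add: nn_integral_cmult)
  finally show ?thesis .
qed

section \<open>The averaged cardinality\<close>

lemma finite_norm_real_vec_le: "finite {k. norm (real_vec k) \<le> s}"
proof (rule finite_subset[OF _ finite_dot2_le])
  show "{k. norm (real_vec k) \<le> s} \<subseteq> {k. dot2 k k \<le> \<lfloor>s\<^sup>2\<rfloor>}"
  proof clarify
    fix a b assume "norm (real_vec (a, b)) \<le> s"
    then have "(norm (real_vec (a, b)))\<^sup>2 \<le> s\<^sup>2" by (intro power_mono) auto
    then show "dot2 (a, b) (a, b) \<le> \<lfloor>s\<^sup>2\<rfloor>"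
      using dot2_self_nonneg[of "(a, b)"] by (simp add: norm_real_vec le_floor_iff)
  qed
qed

text \<open>
Only finitely many lattice points \<open>k\<close> yield a grid point in \<open>\<Omega>\<close> for some \<open>\<xi>\<close> in the unit square.
After exchanging the integrals, the sum over them and the integral over \<open>\<xi>\<close> combine to an integral
over the plane.
\<close>

lemma integral_stencils_card_le_count_bound:
  assumes h: "h > 0" and U: "convex_on \<Omega> U" and \<Omega>: "compact \<Omega>"
    and d: "\<And>x y. x \<in> \<Omega> \<Longrightarrow> y \<in> \<Omega> \<Longrightarrow> dist x y \<le> d"
    and T[measurable]: "T \<in> sets borel"
  defines "n \<equiv> nat \<lfloor>(d / h)\<^sup>2\<rfloor>"
  shows "(\<integral>\<^sup>+\<xi>\<in>{0..1} \<times> {0..1}. (\<integral>\<^sup>+\<theta>\<in>T.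
       of_nat (stencils_card (grid_points \<Omega> h \<theta> \<xi>) (minimal_stencils h \<theta> (grid_points \<Omega> h \<theta> \<xi>) U)) \<partial>lborel) \<partial>lborel)
    \<le> (\<integral>\<^sup>+\<theta>\<in>T. ennreal (1 / h\<^sup>2) * (\<integral>\<^sup>+x. count_bound h n \<Omega> U \<theta> x \<partial>lborel) \<partial>lborel)"
proof -
  let ?Q = "{0..1} \<times> {0..1} :: (real \<times> real) set"
  let ?pt = "\<lambda>\<theta> \<xi> k. h *\<^sub>R rot \<theta> (\<xi> + real_vec k)"
  obtain r where r: "\<And>x. x \<in> \<Omega> \<Longrightarrow> norm x \<le> r"
    using compact_imp_bounded[OF \<Omega>] by (auto simp: bounded_iff)
  define A where "A = {k. norm (real_vec k) \<le> r / h + 2}"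
  have finA: "finite A" unfolding A_def by (rule finite_norm_real_vec_le)
  have inA: "k \<in> A" if \<xi>: "\<xi> \<in> ?Q" and k: "?pt \<theta> \<xi> k \<in> \<Omega>" for \<theta> \<xi> k
  proof -
    have "h * norm (\<xi> + real_vec k) \<le> r" using r[OF k] h by simp
    then have "norm (\<xi> + real_vec k) \<le> r / h" using h by (simp add: field_simps)
    moreover have "norm \<xi> \<le> 2"
      using norm_Pair_le[of "fst \<xi>" "snd \<xi>"] \<xi> by (auto simp: mem_Times_iff)
    moreover have "norm (real_vec k) \<le> norm (\<xi> + real_vec k) + norm \<xi>"
      using norm_triangle_ineq4[of "\<xi> + real_vec k" \<xi>] by simp
    ultimately show ?thesis by (simp add: A_def)
  qed
  define J where "J \<xi> \<theta> = (\<Sum>k\<in>A. count_bound h n \<Omega> U \<theta> (?pt \<theta> \<xi> k))" for \<xi> \<theta>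
  note mc = measurable_count_bound[OF U compact_imp_closed[OF \<Omega>], of h n]
  have [measurable]: "(\<lambda>q. J (fst q) (snd q)) \<in> borel_measurable (borel \<Otimes>\<^sub>M borel)"
  proof -
    have "(\<lambda>q :: (real \<times> real) \<times> real. (snd q, ?pt (snd q) (fst q) k)) \<in> borel_measurable borel" for k
      by (intro borel_measurable_continuous_onI continuous_intros)
    from measurable_compose[OF this mc] show ?thesis
      unfolding J_def borel_prod by (intro borel_measurable_sum) simp
  qed
  have [measurable]: "(\<lambda>q. J (snd q) (fst q)) \<in> borel_measurable (borel \<Otimes>\<^sub>M borel)"
  proof -
    have "(\<lambda>q :: real \<times> (real \<times> real). (fst q, ?pt (fst q) (snd q) k)) \<in> borel_measurable borel" for k
      by (intro borel_measurable_continuous_onI continuous_intros)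
    from measurable_compose[OF this mc] show ?thesis
      unfolding J_def borel_prod by (intro borel_measurable_sum) simp
  qed
  have J2[measurable]: "J \<xi> \<in> borel_measurable borel" for \<xi>
    using measurable_compose[of "\<lambda>\<theta>. (\<xi>, \<theta>)" borel "borel \<Otimes>\<^sub>M borel" "\<lambda>q. J (fst q) (snd q)"] by simp
  have J1[measurable]: "(\<lambda>\<xi>. J \<xi> \<theta>) \<in> borel_measurable borel" for \<theta>
    using measurable_compose[of "\<lambda>\<xi>. (\<xi>, \<theta>)" borel "borel \<Otimes>\<^sub>M borel" "\<lambda>q. J (fst q) (snd q)"] by simp
  have [measurable]: "?Q \<in> sets borel" by (intro borel_closed closed_Times) auto
  have "(\<integral>\<^sup>+\<xi>\<in>?Q. (\<integral>\<^sup>+\<theta>\<in>T. of_nat (stencils_card (grid_points \<Omega> h \<theta> \<xi>)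
            (minimal_stencils h \<theta> (grid_points \<Omega> h \<theta> \<xi>) U)) \<partial>lborel) \<partial>lborel)
      \<le> (\<integral>\<^sup>+\<xi>\<in>?Q. (\<integral>\<^sup>+\<theta>\<in>T. J \<xi> \<theta> \<partial>lborel) \<partial>lborel)"
  proof (rule nn_integral_mono)
    fix \<xi> :: "real \<times> real"
    show "(\<integral>\<^sup>+\<theta>\<in>T. of_nat (stencils_card (grid_points \<Omega> h \<theta> \<xi>)
            (minimal_stencils h \<theta> (grid_points \<Omega> h \<theta> \<xi>) U)) \<partial>lborel) * indicator ?Q \<xi>
        \<le> (\<integral>\<^sup>+\<theta>\<in>T. J \<xi> \<theta> \<partial>lborel) * indicator ?Q \<xi>"
    proof (cases "\<xi> \<in> ?Q")
      case True
      have "of_nat (stencils_card (grid_points \<Omega> h \<theta> \<xi>) (minimal_stencils h \<theta> (grid_points \<Omega> h \<theta> \<xi>) U)) \<le> J \<xi> \<theta>" for \<theta>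
        unfolding J_def n_def by (rule stencils_card_le_sum_count_bound[OF h U d finA inA[OF True]])
      then show ?thesis by (intro mult_right_mono nn_integral_mono) auto
    qed simp
  qed
  also have "\<dots> = (\<integral>\<^sup>+\<xi>. (\<integral>\<^sup>+\<theta>. J \<xi> \<theta> * indicator T \<theta> * indicator ?Q \<xi> \<partial>lborel) \<partial>lborel)"
    by (intro nn_integral_cong nn_integral_multc[symmetric]) measurable
  also have "\<dots> = (\<integral>\<^sup>+\<theta>. (\<integral>\<^sup>+\<xi>. J \<xi> \<theta> * indicator T \<theta> * indicator ?Q \<xi> \<partial>lborel) \<partial>lborel)"
    by (rule lborel_pair.Fubini') measurable
  also have "\<dots> = (\<integral>\<^sup>+\<theta>. (\<integral>\<^sup>+\<xi>. J \<xi> \<theta> * indicator ?Q \<xi> * indicator T \<theta> \<partial>lborel) \<partial>lborel)"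
    by (simp only: mult.assoc mult.commute[of "indicator T _"])
  also have "\<dots> = (\<integral>\<^sup>+\<theta>\<in>T. (\<integral>\<^sup>+\<xi>\<in>?Q. J \<xi> \<theta> \<partial>lborel) \<partial>lborel)"
    by (intro nn_integral_cong nn_integral_multc) measurable
  also have "\<dots> \<le> (\<integral>\<^sup>+\<theta>\<in>T. ennreal (1 / h\<^sup>2) * (\<integral>\<^sup>+x. count_bound h n \<Omega> U \<theta> x \<partial>lborel) \<partial>lborel)"
  proof (intro nn_integral_mono mult_right_mono)
    fix \<theta> :: real
    have "(\<lambda>y :: real \<times> real. (\<theta>, y)) \<in> borel_measurable borel"
      by (intro borel_measurable_continuous_onI continuous_intros)
    from measurable_compose[OF this mc] have m: "count_bound h n \<Omega> U \<theta> \<in> borel_measurable borel" by simp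
    have "(\<lambda>y. h *\<^sub>R rot \<theta> y) \<in> borel_measurable borel"
      by (intro borel_measurable_continuous_onI continuous_intros)
    from measurable_compose[OF this m]
    have "(\<integral>\<^sup>+\<xi>\<in>?Q. J \<xi> \<theta> \<partial>lborel) \<le> (\<integral>\<^sup>+y. count_bound h n \<Omega> U \<theta> (h *\<^sub>R rot \<theta> y) \<partial>lborel)"
      unfolding J_def by (rule nn_integral_unit_square_le[OF _ finA])
    then show "(\<integral>\<^sup>+\<xi>\<in>?Q. J \<xi> \<theta> \<partial>lborel) \<le> ennreal (1 / h\<^sup>2) * (\<integral>\<^sup>+x. count_bound h n \<Omega> U \<theta> x \<partial>lborel)"
      using nn_integral_scaled_rot[OF m h] by simp
  qed simp
  finally show ?thesis .
qed

lemma integral_count_bound_le: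
  assumes h: "h > 0" and U: "convex_on \<Omega> U" and \<Omega>: "compact \<Omega>"
  shows "(\<integral>\<^sup>+\<theta>\<in>{0..pi/2}. ennreal (1 / h\<^sup>2) * (\<integral>\<^sup>+x. count_bound h n \<Omega> U \<theta> x \<partial>lborel) \<partial>lborel)
    \<le> ennreal (1 / h\<^sup>2 * (2 * pi + 8 * (\<Sum>(f, g)\<in>bases_upto n. 1 / (norm (real_vec f) * norm (real_vec g))))
        * measure lebesgue \<Omega>)"
proof -
  note cl = compact_imp_closed[OF \<Omega>]
  define \<mu> where "\<mu> = measure lebesgue \<Omega>"
  have \<mu>: "emeasure lborel \<Omega> = ennreal \<mu>"
    using emeasure_eq_ennreal_measure[of lborel \<Omega>] emeasure_compact_finite[OF \<Omega>] borel_closed[OF cl]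
    by (simp add: \<mu>_def measure_completion less_top)
  define w where "w = (\<lambda>(f, g). 1 / (norm (real_vec f) * norm (real_vec g)))"
  have w0: "w p \<ge> 0" for p by (simp add: w_def split: prod.split)
  define G where "G p \<theta> = (\<integral>\<^sup>+m. indicator (flip_set \<Omega> U (half_sum h p) (half_diff h p)) (\<theta>, m) \<partial>(lborel :: (real \<times> real) measure))" for p \<theta>
  have [measurable]: "G p \<in> borel_measurable borel" for p
  proof -
    have [measurable]: "flip_set \<Omega> U (half_sum h p) (half_diff h p) \<in> sets (borel \<Otimes>\<^sub>M borel)"
      by (rule measurable_flip_set[OF U cl])
    show ?thesis unfolding G_def by measurable
  qed
  have "(\<integral>\<^sup>+\<theta>\<in>{0..pi/2}. ennreal (1 / h\<^sup>2) * (\<integral>\<^sup>+x. count_bound h n \<Omega> U \<theta> x \<partial>lborel) \<partial>lborel)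
     \<le> (\<integral>\<^sup>+\<theta>\<in>{0..pi/2}. ennreal (1 / h\<^sup>2) * (4 * ennreal \<mu> + (\<Sum>p\<in>bases_upto n. G p \<theta>)) \<partial>lborel)"
    using nn_integral_count_bound_le[OF U cl, of h n]
    by (intro nn_integral_mono mult_right_mono mult_left_mono) (auto simp: G_def \<mu>)
  also have "\<dots> = (\<integral>\<^sup>+\<theta>. ennreal (1 / h\<^sup>2) * (4 * ennreal \<mu> * indicator {0..pi/2} \<theta> + (\<Sum>p\<in>bases_upto n. G p \<theta> * indicator {0..pi/2} \<theta>)) \<partial>lborel)"
    by (intro nn_integral_cong) (simp add: distrib_left distrib_right sum_distrib_right mult.assoc)
  also have "\<dots> = ennreal (1 / h\<^sup>2) * (4 * ennreal \<mu> * ennreal (pi/2) + (\<Sum>p\<in>bases_upto n. \<integral>\<^sup>+\<theta>\<in>{0..pi/2}. G p \<theta> \<partial>lborel))"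
    by (simp add: nn_integral_cmult nn_integral_add nn_integral_sum)
  also have "\<dots> \<le> ennreal (1 / h\<^sup>2) * (4 * ennreal \<mu> * ennreal (pi/2) + (\<Sum>p\<in>bases_upto n. ennreal (8 * w p) * ennreal \<mu>))"
  proof (intro mult_left_mono add_left_mono sum_mono)
    fix p assume "p \<in> bases_upto n"
    moreover obtain f g where "p = (f, g)" by (cases p)
    ultimately show "(\<integral>\<^sup>+\<theta>\<in>{0..pi/2}. G p \<theta> \<partial>lborel) \<le> ennreal (8 * w p) * ennreal \<mu>"
      using nn_integral_flip_set_le[OF U cl h, of f g n] by (simp add: G_def w_def \<mu>)
  qed simp_all
  also have "\<dots> = ennreal (1 / h\<^sup>2 * (2 * pi + 8 * sum w (bases_upto n)) * \<mu>)"
  proof -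
    have \<mu>0: "\<mu> \<ge> 0" by (simp add: \<mu>_def)
    have "(\<Sum>p\<in>bases_upto n. ennreal (8 * w p) * ennreal \<mu>) = (\<Sum>p\<in>bases_upto n. ennreal (8 * w p * \<mu>))"
      using \<mu>0 w0 by (intro sum.cong) (auto simp: ennreal_mult)
    also have "\<dots> = ennreal (\<Sum>p\<in>bases_upto n. 8 * w p * \<mu>)"
      using \<mu>0 w0 by (intro sum_ennreal) auto
    also have "(\<Sum>p\<in>bases_upto n. 8 * w p * \<mu>) = 8 * sum w (bases_upto n) * \<mu>"
      by (simp add: sum_distrib_left sum_distrib_right)
    finally have *: "(\<Sum>p\<in>bases_upto n. ennreal (8 * w p) * ennreal \<mu>) = ennreal (8 * sum w (bases_upto n) * \<mu>)" .
    have "4 * ennreal \<mu> * ennreal (pi/2) = ennreal 4 * ennreal \<mu> * ennreal (pi/2)" by simp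
    also have "\<dots> = ennreal (4 * \<mu> * (pi / 2))"
      using \<mu>0 by (simp only: ennreal_mult[symmetric] mult_nonneg_nonneg zero_le_numeral) (simp add: ennreal_mult[symmetric])
    finally have "4 * ennreal \<mu> * ennreal (pi/2) = ennreal (4 * \<mu> * (pi / 2))" .
    moreover have "sum w (bases_upto n) \<ge> 0" by (intro sum_nonneg w0)
    ultimately show ?thesis
      unfolding * using \<mu>0 by (simp add: algebra_simps flip: ennreal_plus ennreal_mult)
  qed
  finally show ?thesis by (simp add: \<mu>_def w_def)
qed

theorem theorem1p11:
  shows "\<exists>C::real. C > 0 \<and>
    (\<forall>(\<Omega> :: (real \<times> real) set) (h :: real) (U :: real \<times> real \<Rightarrow> real).
       compact \<Omega> \<longrightarrow> convex \<Omega> \<longrightarrow> h > 0 \<longrightarrow> diameter \<Omega> / h \<ge> 2 \<longrightarrow> convex_on \<Omega> U \<longrightarrow>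
       (\<integral>\<^sup>+\<xi>\<in>{0..1} \<times> {0..1}.
          (\<integral>\<^sup>+\<theta>\<in>{0..pi / 2}.
             of_nat (stencils_card (grid_points \<Omega> h \<theta> \<xi>)
                       (minimal_stencils h \<theta> (grid_points \<Omega> h \<theta> \<xi>) U))
           \<partial>lebesgue)
        \<partial>lebesgue)
       \<le> ennreal (C * (measure lebesgue \<Omega> / h\<^sup>2) * (ln (diameter \<Omega> / h))\<^sup>2))"
  \<comment> \<open>\<open>4640 = 32 + 8 * 576\<close>: the unit vectors give \<open>2 pi \<le> 32 (ln R)\<^sup>2\<close>, as \<open>ln R \<ge> 1/2\<close>; the other
    directions give 8 times the sum over the bases, whose constant is 576.\<close>
proof (intro exI[of _ 4640] conjI allI impI)
  fix \<Omega> :: "(real \<times> real) set" and h :: real and U :: "real \<times> real \<Rightarrow> real"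
  assume \<Omega>: "compact \<Omega>" and h: "h > 0" and R: "diameter \<Omega> / h \<ge> 2" and U: "convex_on \<Omega> U"
  define R where "R = diameter \<Omega> / h"
  define n where "n = nat \<lfloor>R\<^sup>2\<rfloor>"
  define S where "S = (\<Sum>(f, g)\<in>bases_upto n. 1 / (norm (real_vec f) * norm (real_vec g)))"
  have R2: "R \<ge> 2" using R by (simp add: R_def)
  then have "R\<^sup>2 \<ge> 2\<^sup>2" by (intro power_mono) auto
  then have n: "n > 0" "real n \<le> R\<^sup>2" unfolding n_def by (auto simp: nat_less_eq_zless)
  have S: "S \<le> 576 * (ln R)\<^sup>2" unfolding S_def by (rule sum_bases_upto_le_ln[OF R2 n])
  have "ln 2 \<le> ln R" using R2 by simp
  then have "1/2 \<le> ln R" using ln2_ge_two_thirds by linarith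
  then have "(1/2)\<^sup>2 \<le> (ln R)\<^sup>2" by (intro power_mono) auto
  then have "2 * pi \<le> 32 * (ln R)\<^sup>2" using pi_less_4 by (simp add: power2_eq_square)
  then have fin: "2 * pi + 8 * S \<le> 4640 * (ln R)\<^sup>2" using S by linarith
  have dist: "dist x y \<le> diameter \<Omega>" if "x \<in> \<Omega>" "y \<in> \<Omega>" for x y
    using diameter_bounded_bound[OF compact_imp_bounded[OF \<Omega>] that] .
  have "(\<integral>\<^sup>+\<xi>\<in>{0..1} \<times> {0..1}. (\<integral>\<^sup>+\<theta>\<in>{0..pi / 2}.
       of_nat (stencils_card (grid_points \<Omega> h \<theta> \<xi>) (minimal_stencils h \<theta> (grid_points \<Omega> h \<theta> \<xi>) U)) \<partial>lborel) \<partial>lborel)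
    \<le> (\<integral>\<^sup>+\<theta>\<in>{0..pi / 2}. ennreal (1 / h\<^sup>2) * (\<integral>\<^sup>+x. count_bound h n \<Omega> U \<theta> x \<partial>lborel) \<partial>lborel)"
    unfolding n_def R_def
    by (rule integral_stencils_card_le_count_bound[OF h U \<Omega> dist]) auto
  also have "\<dots> \<le> ennreal (1 / h\<^sup>2 * (2 * pi + 8 * S) * measure lebesgue \<Omega>)"
    unfolding S_def by (rule integral_count_bound_le[OF h U \<Omega>])
  also have "\<dots> \<le> ennreal (1 / h\<^sup>2 * (4640 * (ln R)\<^sup>2) * measure lebesgue \<Omega>)"
    using fin by (intro ennreal_leI mult_right_mono mult_left_mono) auto
  finally show "(\<integral>\<^sup>+\<xi>\<in>{0..1} \<times> {0..1}. (\<integral>\<^sup>+\<theta>\<in>{0..pi / 2}.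
       of_nat (stencils_card (grid_points \<Omega> h \<theta> \<xi>) (minimal_stencils h \<theta> (grid_points \<Omega> h \<theta> \<xi>) U)) \<partial>lebesgue) \<partial>lebesgue)
    \<le> ennreal (4640 * (measure lebesgue \<Omega> / h\<^sup>2) * (ln (diameter \<Omega> / h))\<^sup>2)"
    by (simp add: nn_integral_completion R_def mult_ac)
qed simp

end
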